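(* Let $\mathcal A$ be a formal category and let $\underline{\mathsf{Cyl}}=(\mathsf{Cyl},i_0,i_1,p,v,\mathsf S,r_0,r_1,s,\Gamma_{ul},\Gamma_{lr},\Gamma_{ur})$ be a cylinder in $\mathcal A$ equipped with a contraction structure $p$, an involution structure $v$ compatible with $p$, a subdivision structure $(\mathsf S,r_0,r_1,s)$ compatible with $p$, an upper left connection structure $\Gamma_{ul}$, a lower right connection structure $\Gamma_{lr}$, and an upper right connection structure $\Gamma_{ur}$. Suppose that $\mathcal A$ has mapping cylinders with respect to $\underline{\mathsf{Cyl}}$, that $\Gamma_{lr}$ and $\Gamma_{ur}$ are compatible with the subdivision structure $(\mathsf S,r_0,r_1,s)$, and that $\mathsf{Cyl}$ preserves mapping cylinders with respect to $\underline{\mathsf{Cyl}}$. Let $\underline{\mathsf{coCyl}}=(\mathsf{coCyl},e_0,e_1,c)$ be a co-cylinder in $\mathcal A$ equipped with a contraction structure $c$. Suppose that $\underline{\mathsf{Cyl}}$ is left adjoint to $\underline{\mathsf{coCyl}}$, and that the adjunction between $\mathsf{Cyl}$ and $\mathsf{coCyl}$ is compatible with $p$ and $c$. Let $j:a_0\to a_1$ be an arrow of $\mathcal A$ which is a cofibration with respect to $\underline{\mathsf{Cyl}}$, and let $f:a_2\to a_3$ be an arrow of $\mathcal A$ which is a trivial normally cloven fibration with respect to $\underline{\mathsf{coCyl}}$. Then for any arrows $g_0:a_0\to a_2$ and $g_1:a_1\to a_3$ of $\mathcal A$ with $f\circ g_0=g_1\circ j$, there is an arrow $l:a_1\to a_2$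 of $\mathcal A$ such that $l\circ j=g_0$ and $f\circ l=g_1$.
   Context: Formal categories. Let $\mathcal C$ be a strict 2-category with a final object $1$. For an object $\mathcal A$ of $\mathcal C$, an object of $\mathcal A$ is a 1-arrow $1\to\mathcal A$ and an arrow of $\mathcal A$ is a 2-arrow between such; composition, commutative diagrams, pushouts and pullbacks in $\mathcal A$ are those of the category $\mathrm{Hom}_{\mathcal C}(1,\mathcal A)$. For 1-arrows $F,F_0,F_1:\mathcal A\to\mathcal A$, a 2-arrow $\eta:F_0\to F_1$, an object $a$ and an arrow $f$ of $\mathcal A$: $F(a)=F\circ a$, $F(f)$ is the whiskering of $F$ and $f$, $\eta(a):F_0(a)\to F_1(a)$ is the whiskering of $\eta$ and $a$; $F\cdot\eta$, $\eta\cdot F$ are whiskerings. Standing assumption: for all objects $\mathcal A_0,\mathcal A_1$ of $\mathcal C$ and objects $a$ of $\mathcal A_0$, evaluation at $a$ sends pushout (resp. pullback) squares of $\mathrm{Hom}_{\mathcal C}(\mathcal A_0,\mathcal A_1)$ to pushout (resp. pullback) squares of $\mathcal A_1$. (For $\mathcal C$ the 2-category of categories these are ordinary categories, functors and natural transformations.) $\mathcal A$ is a fixed object of $\mathcal C$. A cylinder in $\mathcal A$ is a 1-arrow $\mathsf{Cyl}:\mathcal A\to\mathcal A$ with 2-arrows $i_0,i_1:\mathrm{id}_{\mathcal A}\to\mathsf{Cyl}$. Contraction: $p:\mathsf{Cyl}\to\mathrm{id}_{\mathcal A}$ with $pi_0=pi_1=\mathrm{id}$. Involution: $v:\mathsf{Cyl}\to\mathsf{Cyl}$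 with $vi_0=i_1$, $vi_1=i_0$; compatible with $p$ if $pv=p$. Subdivision: a 1-arrow $\mathsf S:\mathcal A\to\mathcal A$, 2-arrows $r_0,r_1:\mathsf{Cyl}\to\mathsf S$ with $r_0i_0=r_1i_1$ a pushout square of $i_0$ and $i_1$ in $\mathrm{Hom}_{\mathcal C}(\mathcal A,\mathcal A)$, and $s:\mathsf{Cyl}\to\mathsf S$ with $si_0=r_1i_0$, $si_1=r_0i_1$; compatible with $p$ if $\overline ps=p$, where $\overline p:\mathsf S\to\mathrm{id}_{\mathcal A}$ is the unique 2-arrow with $\overline pr_0=\overline pr_1=p$. Upper left connection: $\Gamma_{ul}:\mathsf{Cyl}^2\to\mathsf{Cyl}$ with $\Gamma_{ul}(i_0\cdot\mathsf{Cyl})=\Gamma_{ul}(\mathsf{Cyl}\cdot i_0)=\mathrm{id}$, $\Gamma_{ul}(i_1\cdot\mathsf{Cyl})=\Gamma_{ul}(\mathsf{Cyl}\cdot i_1)=i_1p$. Lower right connection: $\Gamma_{lr}:\mathsf{Cyl}^2\to\mathsf{Cyl}$ with $\Gamma_{lr}(i_1\cdot\mathsf{Cyl})=\Gamma_{lr}(\mathsf{Cyl}\cdot i_1)=\mathrm{id}$, $\Gamma_{lr}(i_0\cdot\mathsf{Cyl})=\Gamma_{lr}(\mathsf{Cyl}\cdot i_0)=i_0p$. Upper right connection: $\Gamma_{ur}:\mathsf{Cyl}^2\to\mathsf{Cyl}$ with $\Gamma_{ur}(i_0\cdot\mathsf{Cyl})=\mathrm{id}$, $\Gamma_{ur}(\mathsf{Cyl}\cdot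 i_1)=v$, $\Gamma_{ur}(\mathsf{Cyl}\cdot i_0)=\Gamma_{ur}(i_1\cdot\mathsf{Cyl})=i_0p$. $\Gamma_{lr},\Gamma_{ur}$ are compatible with $(\mathsf S,r_0,r_1,s)$ if $x(s\cdot\mathsf{Cyl})=p\cdot\mathsf{Cyl}$, where $x:\mathsf S\circ\mathsf{Cyl}\to\mathsf{Cyl}$ is the unique (canonical) 2-arrow with $x(r_0\cdot\mathsf{Cyl})=\Gamma_{lr}$, $x(r_1\cdot\mathsf{Cyl})=\Gamma_{ur}$. A co-cylinder in $\mathcal A$ is a 1-arrow $\mathsf{coCyl}:\mathcal A\to\mathcal A$ with 2-arrows $e_0,e_1:\mathsf{coCyl}\to\mathrm{id}_{\mathcal A}$; contraction: $c:\mathrm{id}_{\mathcal A}\to\mathsf{coCyl}$ with $e_0c=e_1c=\mathrm{id}$. $\underline{\mathsf{Cyl}}$ is left adjoint to $\underline{\mathsf{coCyl}}$ if $\mathsf{Cyl}$ is left adjoint to $\mathsf{coCyl}$ in $\mathcal C$, with natural bijection $\mathsf{adj}:\mathrm{Hom}_{\mathcal A}(\mathsf{Cyl}(a_0),a_1)\to\mathrm{Hom}_{\mathcal A}(a_0,\mathsf{coCyl}(a_1))$, and $e_\epsilon(a_1)\circ\mathsf{adj}(h)=h\circ i_\epsilon(a_0)$ for $\epsilon=0,1$ and all $h$. The adjunction is compatible with $p$ and $c$ if $\mathsf{adj}(f\circ p(a_0))=c(a_1)\circ f$ for all $f:a_0\to a_1$. Mapping cylinder of $f:a_0\to a_1$: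 an object $a_f$ with $d^0_f:\mathsf{Cyl}(a_0)\to a_f$, $d^1_f:a_1\to a_f$ such that $d^0_f\circ i_0(a_0)=d^1_f\circ f$ is a pushout square. $\mathcal A$ has mapping cylinders if every arrow has one. $\mathsf{Cyl}$ preserves mapping cylinders if it carries each such square to a pushout square (with maps $\mathsf{Cyl}(i_0(a_0)),\mathsf{Cyl}(d^0_f),\mathsf{Cyl}(f),\mathsf{Cyl}(d^1_f)$). Cofibration with respect to $\underline{\mathsf{Cyl}}$: $j:a_0\to a_1$ such that for all $f:a_1\to a_2$, $h:\mathsf{Cyl}(a_0)\to a_2$ with $h\circ i_0(a_0)=f\circ j$ there is $k:\mathsf{Cyl}(a_1)\to a_2$ with $k\circ\mathsf{Cyl}(j)=h$, $k\circ i_0(a_1)=f$. Normally cloven fibration with respect to $\underline{\mathsf{coCyl}}$: $f:a_1\to a_2$ for which one can choose, for every object $a_0$ and all $g:a_0\to a_1$, $h:a_0\to\mathsf{coCyl}(a_2)$ with $e_0(a_2)\circ h=f\circ g$, an arrow $k_{a_0}(g,h):a_0\to\mathsf{coCyl}(a_1)$ with $\mathsf{coCyl}(f)\circ k_{a_0}(g,h)=h$, $e_0(a_1)\circ k_{a_0}(g,h)=g$, such that (i) $k_{a_0}(g,c(a_2)\circ f\circ g)=c(a_1)\circ g$, and (ii) $k_{a_{-1}}(g\circ u,h\circ u)=k_{a_0}(g,h)\circ u$ for all $u:a_{-1}\to a_0$. It is trivial if it is also a homotopy equivalence with respect to $\underline{\mathsf{coCyl}}$: there are $f^{-1}:a_2\to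 a_1$ and homotopies from $f^{-1}f$ to $\mathrm{id}(a_1)$ and from $ff^{-1}$ to $\mathrm{id}(a_2)$, where a homotopy from $f_0$ to $f_1$ ($f_0,f_1:b_0\to b_1$) is $h:b_0\to\mathsf{coCyl}(b_1)$ with $e_0(b_1)\circ h=f_0$, $e_1(b_1)\circ h=f_1$. *)

theory Defs
  imports Main
begin

section \<open>Strict 2-categories\<close>

text \<open>
  The compositions are total functions that are only meaningful on composable arguments:
  \<open>G \<odot> F\<close> is composition of 1-arrows (first \<open>F\<close>, then \<open>G\<close>), \<open>\<eta> \<bullet> \<theta>\<close> is vertical composition of
  2-arrows (first \<open>\<theta>\<close>, then \<open>\<eta>\<close>), and \<open>\<eta> \<star> \<theta>\<close> is horizontal composition along \<open>G \<odot> F\<close>, for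
  \<open>\<theta>\<close> a 2-arrow out of \<open>F\<close> and \<open>\<eta>\<close> a 2-arrow out of \<open>G\<close>.
\<close>

record ('o, 'f, 'c) two_cat =
  Obj :: "'o set"
  Arr1 :: "'f set"
  Arr2 :: "'c set"
  dom1 :: "'f \<Rightarrow> 'o"
  cod1 :: "'f \<Rightarrow> 'o"
  id1 :: "'o \<Rightarrow> 'f"
  comp1 :: "'f \<Rightarrow> 'f \<Rightarrow> 'f"  (infixl "\<odot>\<index>" 75)
  dom2 :: "'c \<Rightarrow> 'f"
  cod2 :: "'c \<Rightarrow> 'f"
  id2 :: "'f \<Rightarrow> 'c"
  vcomp :: "'c \<Rightarrow> 'c \<Rightarrow> 'c"  (infixl "\<bullet>\<index>" 65)
  hcomp :: "'c \<Rightarrow> 'c \<Rightarrow> 'c"  (infixl "\<star>\<index>" 70)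

definition hom1 :: "('o, 'f, 'c, 'm) two_cat_scheme \<Rightarrow> 'o \<Rightarrow> 'o \<Rightarrow> 'f set" where
  "hom1 C X Y = {F \<in> Arr1 C. dom1 C F = X \<and> cod1 C F = Y}"

definition hom2 :: "('o, 'f, 'c, 'm) two_cat_scheme \<Rightarrow> 'f \<Rightarrow> 'f \<Rightarrow> 'c set" where
  "hom2 C F G = {\<eta> \<in> Arr2 C. dom2 C \<eta> = F \<and> cod2 C \<eta> = G}"

locale strict_2_category =
  fixes C :: "('o, 'f, 'c, 'm) two_cat_scheme" (structure)
  assumes dom1_cod1_obj: "F \<in> Arr1 C \<Longrightarrow> dom1 C F \<in> Obj C \<and> cod1 C F \<in> Obj C"
    and id1_hom: "X \<in> Obj C \<Longrightarrow> id1 C X \<in> hom1 C X X"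
    and comp1_hom: "\<lbrakk>F \<in> hom1 C X Y; G \<in> hom1 C Y Z\<rbrakk> \<Longrightarrow> G \<odot> F \<in> hom1 C X Z"
    and comp1_assoc: "\<lbrakk>F \<in> hom1 C X Y; G \<in> hom1 C Y Z; H \<in> hom1 C Z W\<rbrakk>
          \<Longrightarrow> (H \<odot> G) \<odot> F = H \<odot> (G \<odot> F)"
    and comp1_id: "F \<in> hom1 C X Y \<Longrightarrow> F \<odot> id1 C X = F \<and> id1 C Y \<odot> F = F"
    and dom2_cod2_parallel: "\<eta> \<in> Arr2 C \<Longrightarrow> dom2 C \<eta> \<in> Arr1 C \<and> cod2 C \<eta> \<in> Arr1 C \<and>
          dom1 C (dom2 C \<eta>) = dom1 C (cod2 C \<eta>) \<and> cod1 C (dom2 C \<eta>) = cod1 C (cod2 C \<eta>)"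
    and id2_hom: "F \<in> Arr1 C \<Longrightarrow> id2 C F \<in> hom2 C F F"
    and vcomp_hom: "\<lbrakk>\<eta> \<in> hom2 C F G; \<theta> \<in> hom2 C G H\<rbrakk> \<Longrightarrow> \<theta> \<bullet> \<eta> \<in> hom2 C F H"
    and vcomp_assoc: "\<lbrakk>\<eta> \<in> hom2 C F G; \<theta> \<in> hom2 C G H; \<kappa> \<in> hom2 C H K\<rbrakk>
          \<Longrightarrow> (\<kappa> \<bullet> \<theta>) \<bullet> \<eta> = \<kappa> \<bullet> (\<theta> \<bullet> \<eta>)"
    and vcomp_id: "\<eta> \<in> hom2 C F G \<Longrightarrow> \<eta> \<bullet> id2 C F = \<eta> \<and> id2 C G \<bullet> \<eta> = \<eta>"
    and hcomp_hom: "\<lbrakk>F \<in> hom1 C X Y; G \<in> hom1 C Y Z; \<eta> \<in> hom2 C F F'; \<theta> \<in> hom2 C G G'\<rbrakk>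
          \<Longrightarrow> \<theta> \<star> \<eta> \<in> hom2 C (G \<odot> F) (G' \<odot> F')"
    and hcomp_assoc: "\<lbrakk>F \<in> hom1 C X Y; G \<in> hom1 C Y Z; H \<in> hom1 C Z W;
          \<eta> \<in> hom2 C F F'; \<theta> \<in> hom2 C G G'; \<kappa> \<in> hom2 C H H'\<rbrakk>
          \<Longrightarrow> (\<kappa> \<star> \<theta>) \<star> \<eta> = \<kappa> \<star> (\<theta> \<star> \<eta>)"
    and hcomp_id: "\<lbrakk>F \<in> hom1 C X Y; \<eta> \<in> hom2 C F F'\<rbrakk>
          \<Longrightarrow> \<eta> \<star> id2 C (id1 C X) = \<eta> \<and> id2 C (id1 C Y) \<star> \<eta> = \<eta>"
    and hcomp_id2: "\<lbrakk>F \<in> hom1 C X Y; G \<in> hom1 C Y Z\<rbrakk>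
          \<Longrightarrow> id2 C G \<star> id2 C F = id2 C (G \<odot> F)"
    and interchange: "\<lbrakk>F \<in> hom1 C X Y; G \<in> hom1 C Y Z;
          \<eta> \<in> hom2 C F F'; \<eta>' \<in> hom2 C F' F''; \<theta> \<in> hom2 C G G'; \<theta>' \<in> hom2 C G' G''\<rbrakk>
          \<Longrightarrow> (\<theta>' \<bullet> \<theta>) \<star> (\<eta>' \<bullet> \<eta>) = (\<theta>' \<star> \<eta>') \<bullet> (\<theta> \<star> \<eta>)"

text \<open>
  Whiskerings \<open>F \<cdot> \<eta>\<close> and \<open>\<eta> \<cdot> F\<close>. On objects \<open>a\<close> and arrows \<open>f\<close> of a formal category the same
  operations give \<open>F(f)\<close> as \<open>F \<rhd> f\<close> and \<open>\<eta>(a)\<close> as \<open>\<eta> \<lhd> a\<close>, while \<open>F(a)\<close> is \<open>F \<odot> a\<close>.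
\<close>

definition whisker_left :: "('o, 'f, 'c, 'm) two_cat_scheme \<Rightarrow> 'f \<Rightarrow> 'c \<Rightarrow> 'c"
    (infixl "\<rhd>\<index>" 70) where
  "F \<rhd>\<^bsub>C\<^esub> \<eta> = id2 C F \<star>\<^bsub>C\<^esub> \<eta>"

definition whisker_right :: "('o, 'f, 'c, 'm) two_cat_scheme \<Rightarrow> 'c \<Rightarrow> 'f \<Rightarrow> 'c"
    (infixl "\<lhd>\<index>" 70) where
  "\<eta> \<lhd>\<^bsub>C\<^esub> F = \<eta> \<star>\<^bsub>C\<^esub> id2 C F"

text \<open>The square \<open>g0 \<bullet> f0 = g1 \<bullet> f1\<close> is a pushout in the category \<open>Hom(X, Y)\<close>.\<close>

definition pushout_square :: "('o, 'f, 'c, 'm) two_cat_scheme \<Rightarrow> 'o \<Rightarrow> 'o \<Rightarrow>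
    'c \<Rightarrow> 'c \<Rightarrow> 'c \<Rightarrow> 'c \<Rightarrow> bool" where
  "pushout_square C X Y f0 f1 g0 g1 \<longleftrightarrow>
    (\<exists>a \<in> hom1 C X Y. \<exists>b0 \<in> hom1 C X Y. \<exists>b1 \<in> hom1 C X Y. \<exists>d \<in> hom1 C X Y.
      f0 \<in> hom2 C a b0 \<and> f1 \<in> hom2 C a b1 \<and> g0 \<in> hom2 C b0 d \<and> g1 \<in> hom2 C b1 d \<and>
      g0 \<bullet> f0 = g1 \<bullet> f1 \<and>
      (\<forall>z \<in> hom1 C X Y. \<forall>h0 \<in> hom2 C b0 z. \<forall>h1 \<in> hom2 C b1 z.
        h0 \<bullet> f0 = h1 \<bullet> f1 \<longrightarrow> (\<exists>!w. w \<in> hom2 C d z \<and> w \<bullet> g0 = h0 \<and> w \<bullet> g1 = h1)))"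
  for C (structure)

text \<open>The square \<open>f0 \<bullet> g0 = f1 \<bullet> g1\<close> is a pullback in the category \<open>Hom(X, Y)\<close>.\<close>

definition pullback_square :: "('o, 'f, 'c, 'm) two_cat_scheme \<Rightarrow> 'o \<Rightarrow> 'o \<Rightarrow>
    'c \<Rightarrow> 'c \<Rightarrow> 'c \<Rightarrow> 'c \<Rightarrow> bool" where
  "pullback_square C X Y f0 f1 g0 g1 \<longleftrightarrow>
    (\<exists>a \<in> hom1 C X Y. \<exists>b0 \<in> hom1 C X Y. \<exists>b1 \<in> hom1 C X Y. \<exists>d \<in> hom1 C X Y.
      f0 \<in> hom2 C b0 d \<and> f1 \<in> hom2 C b1 d \<and> g0 \<in> hom2 C a b0 \<and> g1 \<in> hom2 C a b1 \<and>
      f0 \<bullet> g0 = f1 \<bullet> g1 \<and>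
      (\<forall>z \<in> hom1 C X Y. \<forall>h0 \<in> hom2 C z b0. \<forall>h1 \<in> hom2 C z b1.
        f0 \<bullet> h0 = f1 \<bullet> h1 \<longrightarrow> (\<exists>!w. w \<in> hom2 C z a \<and> g0 \<bullet> w = h0 \<and> g1 \<bullet> w = h1)))"
  for C (structure)

text \<open>Finality is 2-categorical: every \<open>Hom(X, T)\<close> is isomorphic to the terminal category.\<close>

definition final_object :: "('o, 'f, 'c, 'm) two_cat_scheme \<Rightarrow> 'o \<Rightarrow> bool" where
  "final_object C T \<longleftrightarrow> T \<in> Obj C \<and>
    (\<forall>X \<in> Obj C. (\<exists>!t. t \<in> hom1 C X T) \<and> (\<forall>t \<in> hom1 C X T. hom2 C t t = {id2 C t}))"

locale formal_category = strict_2_category C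
  for C :: "('o, 'f, 'c, 'm) two_cat_scheme" (structure) +
  fixes T :: 'o and A :: 'o
  assumes final: "final_object C T"
    and eval_pushout: "\<lbrakk>X \<in> Obj C; Y \<in> Obj C; x \<in> hom1 C T X; pushout_square C X Y f0 f1 g0 g1\<rbrakk>
          \<Longrightarrow> pushout_square C T Y (f0 \<lhd> x) (f1 \<lhd> x) (g0 \<lhd> x) (g1 \<lhd> x)"
    and eval_pullback: "\<lbrakk>X \<in> Obj C; Y \<in> Obj C; x \<in> hom1 C T X; pullback_square C X Y f0 f1 g0 g1\<rbrakk>
          \<Longrightarrow> pullback_square C T Y (f0 \<lhd> x) (f1 \<lhd> x) (g0 \<lhd> x) (g1 \<lhd> x)"
    and A_obj: "A \<in> Obj C"

section \<open>Cylinders and their structures\<close>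

definition cylinder :: "('o, 'f, 'c, 'm) two_cat_scheme \<Rightarrow> 'o \<Rightarrow> 'f \<Rightarrow> 'c \<Rightarrow> 'c \<Rightarrow> bool" where
  "cylinder C A Cyl i0 i1 \<longleftrightarrow>
    Cyl \<in> hom1 C A A \<and> i0 \<in> hom2 C (id1 C A) Cyl \<and> i1 \<in> hom2 C (id1 C A) Cyl"

definition contraction where
  "contraction C A Cyl i0 i1 p \<longleftrightarrow>
    p \<in> hom2 C Cyl (id1 C A) \<and> p \<bullet> i0 = id2 C (id1 C A) \<and> p \<bullet> i1 = id2 C (id1 C A)"
  for C (structure)

definition involution where
  "involution C Cyl i0 i1 v \<longleftrightarrow> v \<in> hom2 C Cyl Cyl \<and> v \<bullet> i0 = i1 \<and> v \<bullet> i1 = i0"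
  for C (structure)

definition involution_compatible where
  "involution_compatible C p v \<longleftrightarrow> p \<bullet> v = p"
  for C (structure)

definition subdivision where
  "subdivision C A Cyl i0 i1 S r0 r1 s \<longleftrightarrow>
    S \<in> hom1 C A A \<and> r0 \<in> hom2 C Cyl S \<and> r1 \<in> hom2 C Cyl S \<and>
    pushout_square C A A i0 i1 r0 r1 \<and>
    s \<in> hom2 C Cyl S \<and> s \<bullet> i0 = r1 \<bullet> i0 \<and> s \<bullet> i1 = r0 \<bullet> i1"
  for C (structure)

definition unique_factorization where
  "unique_factorization C F G g0 g1 h0 h1 w \<longleftrightarrow>
    w \<in> hom2 C F G \<and> w \<bullet> g0 = h0 \<and> w \<bullet> g1 = h1 \<and>
    (\<forall>w' \<in> hom2 C F G. w' \<bullet> g0 = h0 \<and> w' \<bullet> g1 = h1 \<longrightarrow> w' = w)"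
  for C (structure)

definition subdivision_compatible where
  "subdivision_compatible C A p S r0 r1 s \<longleftrightarrow>
    (\<exists>pbar. unique_factorization C S (id1 C A) r0 r1 p p pbar \<and> pbar \<bullet> s = p)"
  for C (structure)

definition upper_left_connection where
  "upper_left_connection C Cyl i0 i1 p \<Gamma> \<longleftrightarrow>
    \<Gamma> \<in> hom2 C (Cyl \<odot> Cyl) Cyl \<and>
    \<Gamma> \<bullet> (i0 \<lhd> Cyl) = id2 C Cyl \<and> \<Gamma> \<bullet> (Cyl \<rhd> i0) = id2 C Cyl \<and>
    \<Gamma> \<bullet> (i1 \<lhd> Cyl) = i1 \<bullet> p \<and> \<Gamma> \<bullet> (Cyl \<rhd> i1) = i1 \<bullet> p"
  for C (structure)

definition lower_right_connection where
  "lower_right_connection C Cyl i0 i1 p \<Gamma> \<longleftrightarrow>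
    \<Gamma> \<in> hom2 C (Cyl \<odot> Cyl) Cyl \<and>
    \<Gamma> \<bullet> (i1 \<lhd> Cyl) = id2 C Cyl \<and> \<Gamma> \<bullet> (Cyl \<rhd> i1) = id2 C Cyl \<and>
    \<Gamma> \<bullet> (i0 \<lhd> Cyl) = i0 \<bullet> p \<and> \<Gamma> \<bullet> (Cyl \<rhd> i0) = i0 \<bullet> p"
  for C (structure)

definition upper_right_connection where
  "upper_right_connection C Cyl i0 i1 p v \<Gamma> \<longleftrightarrow>
    \<Gamma> \<in> hom2 C (Cyl \<odot> Cyl) Cyl \<and>
    \<Gamma> \<bullet> (i0 \<lhd> Cyl) = id2 C Cyl \<and> \<Gamma> \<bullet> (Cyl \<rhd> i1) = v \<and>
    \<Gamma> \<bullet> (Cyl \<rhd> i0) = i0 \<bullet> p \<and> \<Gamma> \<bullet> (i1 \<lhd> Cyl) = i0 \<bullet> p"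
  for C (structure)

definition connections_compatible where
  "connections_compatible C Cyl p S r0 r1 s \<Gamma>lr \<Gamma>ur \<longleftrightarrow>
    (\<exists>x. unique_factorization C (S \<odot> Cyl) Cyl (r0 \<lhd> Cyl) (r1 \<lhd> Cyl) \<Gamma>lr \<Gamma>ur x \<and>
      x \<bullet> (s \<lhd> Cyl) = p \<lhd> Cyl)"
  for C (structure)

definition mapping_cylinder where
  "mapping_cylinder C T A Cyl i0 a0 a1 f af d0 d1 \<longleftrightarrow>
    af \<in> hom1 C T A \<and> d0 \<in> hom2 C (Cyl \<odot> a0) af \<and> d1 \<in> hom2 C a1 af \<and>
    pushout_square C T A (i0 \<lhd> a0) f d0 d1"
  for C (structure)

definition has_mapping_cylinders where
  "has_mapping_cylinders C T A Cyl i0 \<longleftrightarrow>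
    (\<forall>a0 \<in> hom1 C T A. \<forall>a1 \<in> hom1 C T A. \<forall>f \<in> hom2 C a0 a1.
      \<exists>af d0 d1. mapping_cylinder C T A Cyl i0 a0 a1 f af d0 d1)"

definition preserves_mapping_cylinders where
  "preserves_mapping_cylinders C T A Cyl i0 \<longleftrightarrow>
    (\<forall>a0 \<in> hom1 C T A. \<forall>a1 \<in> hom1 C T A. \<forall>f \<in> hom2 C a0 a1. \<forall>af d0 d1.
      mapping_cylinder C T A Cyl i0 a0 a1 f af d0 d1 \<longrightarrow>
      pushout_square C T A (Cyl \<rhd> (i0 \<lhd> a0)) (Cyl \<rhd> f) (Cyl \<rhd> d0) (Cyl \<rhd> d1))"
  for C (structure)

definition cofibration where
  "cofibration C T A Cyl i0 a0 a1 j \<longleftrightarrow>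
    j \<in> hom2 C a0 a1 \<and>
    (\<forall>a2 \<in> hom1 C T A. \<forall>f \<in> hom2 C a1 a2. \<forall>h \<in> hom2 C (Cyl \<odot> a0) a2.
      h \<bullet> (i0 \<lhd> a0) = f \<bullet> j \<longrightarrow>
      (\<exists>k \<in> hom2 C (Cyl \<odot> a1) a2. k \<bullet> (Cyl \<rhd> j) = h \<and> k \<bullet> (i0 \<lhd> a1) = f))"
  for C (structure)

section \<open>Co-cylinders and the adjunction\<close>

definition cocylinder :: "('o, 'f, 'c, 'm) two_cat_scheme \<Rightarrow> 'o \<Rightarrow> 'f \<Rightarrow> 'c \<Rightarrow> 'c \<Rightarrow> bool" where
  "cocylinder C A coCyl e0 e1 \<longleftrightarrow>
    coCyl \<in> hom1 C A A \<and> e0 \<in> hom2 C coCyl (id1 C A) \<and> e1 \<in> hom2 C coCyl (id1 C A)"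

definition cocontraction where
  "cocontraction C A coCyl e0 e1 c \<longleftrightarrow>
    c \<in> hom2 C (id1 C A) coCyl \<and> e0 \<bullet> c = id2 C (id1 C A) \<and> e1 \<bullet> c = id2 C (id1 C A)"
  for C (structure)

text \<open>An adjunction \<open>L \<stileturn> R\<close> internal to the 2-category, by unit and counit.\<close>

definition adjunction where
  "adjunction C A L R unit counit \<longleftrightarrow>
    L \<in> hom1 C A A \<and> R \<in> hom1 C A A \<and>
    unit \<in> hom2 C (id1 C A) (R \<odot> L) \<and> counit \<in> hom2 C (L \<odot> R) (id1 C A) \<and>
    (counit \<lhd> L) \<bullet> (L \<rhd> unit) = id2 C L \<and>
    (R \<rhd> counit) \<bullet> (unit \<lhd> R) = id2 C R"
  for C (structure)

text \<open>The induced natural bijection \<open>Hom(L(a0), a1) \<rightarrow> Hom(a0, R(a1))\<close>, \<open>h \<mapsto> R(h) \<bullet> unit(a0)\<close>.\<close>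

definition adj where
  "adj C R unit a0 h = (R \<rhd> h) \<bullet> (unit \<lhd> a0)"
  for C (structure)

definition cyl_left_adjoint where
  "cyl_left_adjoint C T A Cyl i0 i1 coCyl e0 e1 unit counit \<longleftrightarrow>
    adjunction C A Cyl coCyl unit counit \<and>
    (\<forall>a0 \<in> hom1 C T A. \<forall>a1 \<in> hom1 C T A. \<forall>h \<in> hom2 C (Cyl \<odot> a0) a1.
      (e0 \<lhd> a1) \<bullet> adj C coCyl unit a0 h = h \<bullet> (i0 \<lhd> a0) \<and>
      (e1 \<lhd> a1) \<bullet> adj C coCyl unit a0 h = h \<bullet> (i1 \<lhd> a0))"
  for C (structure)

definition adjunction_compatible where
  "adjunction_compatible C T A coCyl unit p c \<longleftrightarrow>
    (\<forall>a0 \<in> hom1 C T A. \<forall>a1 \<in> hom1 C T A. \<forall>f \<in> hom2 C a0 a1.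
      adj C coCyl unit a0 (f \<bullet> (p \<lhd> a0)) = (c \<lhd> a1) \<bullet> f)"
  for C (structure)

definition cleavage where
  "cleavage C T A coCyl e0 a1 a2 f k \<longleftrightarrow>
    (\<forall>a0 \<in> hom1 C T A. \<forall>g \<in> hom2 C a0 a1. \<forall>h \<in> hom2 C a0 (coCyl \<odot> a2).
      (e0 \<lhd> a2) \<bullet> h = f \<bullet> g \<longrightarrow>
      k a0 g h \<in> hom2 C a0 (coCyl \<odot> a1) \<and>
      (coCyl \<rhd> f) \<bullet> k a0 g h = h \<and> (e0 \<lhd> a1) \<bullet> k a0 g h = g)"
  for C (structure)

definition normally_cloven_fibration ::
  "('o, 'f, 'c, 'm) two_cat_scheme \<Rightarrow> 'o \<Rightarrow> 'o \<Rightarrow> 'f \<Rightarrow> 'c \<Rightarrow> 'c \<Rightarrow> 'f \<Rightarrow> 'f \<Rightarrow> 'c \<Rightarrow> bool" where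
  "normally_cloven_fibration C T A coCyl e0 c a1 a2 f \<longleftrightarrow>
    f \<in> hom2 C a1 a2 \<and>
    (\<exists>k. cleavage C T A coCyl e0 a1 a2 f k \<and>
      (\<forall>a0 \<in> hom1 C T A. \<forall>g \<in> hom2 C a0 a1.
        k a0 g ((c \<lhd> a2) \<bullet> f \<bullet> g) = (c \<lhd> a1) \<bullet> g) \<and>
      (\<forall>a0 \<in> hom1 C T A. \<forall>b \<in> hom1 C T A. \<forall>u \<in> hom2 C b a0.
        \<forall>g \<in> hom2 C a0 a1. \<forall>h \<in> hom2 C a0 (coCyl \<odot> a2).
        (e0 \<lhd> a2) \<bullet> h = f \<bullet> g \<longrightarrow> k b (g \<bullet> u) (h \<bullet> u) = k a0 g h \<bullet> u))"
  for C (structure)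

definition cocyl_homotopy where
  "cocyl_homotopy C coCyl e0 e1 b0 b1 f0 f1 h \<longleftrightarrow>
    h \<in> hom2 C b0 (coCyl \<odot> b1) \<and> (e0 \<lhd> b1) \<bullet> h = f0 \<and> (e1 \<lhd> b1) \<bullet> h = f1"
  for C (structure)

definition cocyl_homotopy_equivalence where
  "cocyl_homotopy_equivalence C coCyl e0 e1 a1 a2 f \<longleftrightarrow>
    f \<in> hom2 C a1 a2 \<and>
    (\<exists>f' \<in> hom2 C a2 a1.
      (\<exists>h. cocyl_homotopy C coCyl e0 e1 a1 a1 (f' \<bullet> f) (id2 C a1) h) \<and>
      (\<exists>h. cocyl_homotopy C coCyl e0 e1 a2 a2 (f \<bullet> f') (id2 C a2) h))"
  for C (structure)

definition trivial_normally_cloven_fibration where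
  "trivial_normally_cloven_fibration C T A coCyl e0 e1 c a1 a2 f \<longleftrightarrow>
    normally_cloven_fibration C T A coCyl e0 c a1 a2 f \<and>
    cocyl_homotopy_equivalence C coCyl e0 e1 a1 a2 f"

end

theory Submission
  imports Defs
begin

text \<open>
  Points of \<open>A\<close>, that is 1-arrows \<open>T \<rightarrow> A\<close>, form a category on which \<open>Cyl\<close> acts as a functor, so the
  argument is ordinary homotopy theory with a cylinder. The adjunction turns the fibration structure of
  \<open>f : b \<rightarrow> b'\<close> into a choice \<open>K a g H\<close> of lifts of homotopies \<open>H : Cyl(a) \<rightarrow> b'\<close> starting at \<open>f \<bullet> g\<close>,
  which is natural in \<open>a\<close> and lifts constant homotopies to constant ones
  (\<open>cloven_fibration_lifting\<close>).

  The homotopical input is that inverses are strict. Restricting the canonical \<open>x : S \<odot> Cyl \<rightarrow> Cyl\<close> along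
  \<open>S \<rhd> i1\<close> yields \<open>y : S \<rightarrow> Cyl\<close> with \<open>y \<bullet> r0 = id\<close>, \<open>y \<bullet> r1 = v\<close> and \<open>y \<bullet> s = i1 \<bullet> p\<close>
  (\<open>strict_left_inverse\<close>): a reversed homotopy followed by the homotopy itself is, on the nose, constant at
  the end point.

  Given a trivial fibration \<open>f\<close> with homotopy inverse \<open>f'\<close>, lifting the homotopy \<open>f \<bullet> f' \<sim> id\<close> replaces
  \<open>f'\<close> by a section \<open>t\<close> of \<open>f\<close>, still with a homotopy \<open>D\<close> from \<open>t \<bullet> f\<close> to \<open>id\<close>. As in Dold's theorem on
  fibre homotopy equivalences, precede \<open>D\<close> by \<open>t \<bullet> f\<close> applied to the reverse of \<open>D\<close>. Under \<open>f\<close> the two halves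
  become the reverse of \<open>f \<bullet> D\<close> and \<open>f \<bullet> D\<close>, so strict cancellation makes this new homotopy from \<open>t \<bullet> f\<close>
  to \<open>id\<close> constant over \<open>b'\<close> (\<open>shrinkable\<close>).

  For a square \<open>f \<bullet> g0 = g1 \<bullet> j\<close> the arrow \<open>t \<bullet> g1\<close> fits the lower triangle exactly, and the upper one up to
  a homotopy lying over \<open>b'\<close>. The cofibration \<open>j\<close> extends this homotopy to \<open>k\<close>, whose end point \<open>q\<close>
  fits the upper triangle, but the lower one only up to \<open>f \<bullet> k\<close>. Lifting the reverse of
  \<open>f \<bullet> k\<close> from \<open>q\<close> repairs the lower triangle; over \<open>a0\<close> the lifted homotopy is constant, hence by naturality and
  normality so is its lift, and the upper triangle survives (\<open>cofibration_lift\<close>).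
\<close>

section \<open>Whiskering\<close>

context strict_2_category
begin

lemma hom1_obj:
  assumes "F \<in> hom1 C X Y" shows "X \<in> Obj C" "Y \<in> Obj C"
  using assms dom1_cod1_obj by (auto simp: hom1_def)

lemma hom1_id2: "F \<in> hom1 C X Y \<Longrightarrow> id2 C F \<in> hom2 C F F"
  by (rule id2_hom) (simp add: hom1_def)

lemma hom2_cod_hom1:
  assumes "F \<in> hom1 C X Y" "\<eta> \<in> hom2 C F G"
  shows "G \<in> hom1 C X Y"
  using assms dom2_cod2_parallel[of \<eta>] by (auto simp: hom1_def hom2_def)

lemma whisker_left_hom:
  assumes "F \<in> hom1 C X Y" "H \<in> hom1 C Y Z" "\<eta> \<in> hom2 C F G"
  shows "H \<rhd> \<eta> \<in> hom2 C (H \<odot> F) (H \<odot> G)"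
  unfolding whisker_left_def by (rule hcomp_hom[OF assms(1,2,3) hom1_id2[OF assms(2)]])

lemma whisker_right_hom:
  assumes "F \<in> hom1 C X Y" "G \<in> hom1 C Y Z" "\<theta> \<in> hom2 C G G'"
  shows "\<theta> \<lhd> F \<in> hom2 C (G \<odot> F) (G' \<odot> F)"
  unfolding whisker_right_def by (rule hcomp_hom[OF assms(1,2) hom1_id2[OF assms(1)] assms(3)])

lemma whisker_left_vcomp:
  assumes "F \<in> hom1 C X Y" "H \<in> hom1 C Y Z" "\<eta> \<in> hom2 C F F'" "\<theta> \<in> hom2 C F' F''"
  shows "H \<rhd> (\<theta> \<bullet> \<eta>) = (H \<rhd> \<theta>) \<bullet> (H \<rhd> \<eta>)"
  using interchange[OF assms(1,2,3,4) hom1_id2[OF assms(2)] hom1_id2[OF assms(2)]]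
    vcomp_id[OF hom1_id2[OF assms(2)]]
  by (simp add: whisker_left_def)

lemma whisker_right_vcomp:
  assumes "F \<in> hom1 C X Y" "G \<in> hom1 C Y Z" "\<eta> \<in> hom2 C G G'" "\<theta> \<in> hom2 C G' G''"
  shows "(\<theta> \<bullet> \<eta>) \<lhd> F = (\<theta> \<lhd> F) \<bullet> (\<eta> \<lhd> F)"
  using interchange[OF assms(1,2) hom1_id2[OF assms(1)] hom1_id2[OF assms(1)] assms(3,4)]
    vcomp_id[OF hom1_id2[OF assms(1)]]
  by (simp add: whisker_right_def)

lemma whisker_naturality:
  assumes "F \<in> hom1 C X Y" "G \<in> hom1 C Y Z" "\<eta> \<in> hom2 C F F'" "\<theta> \<in> hom2 C G G'"
  shows "(\<theta> \<lhd> F') \<bullet> (G \<rhd> \<eta>) = (G' \<rhd> \<eta>) \<bullet> (\<theta> \<lhd> F)"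
proof -
  have F': "F' \<in> hom1 C X Y" and G': "G' \<in> hom1 C Y Z"
    using assms hom2_cod_hom1 by blast+
  show ?thesis
    using interchange[OF assms(1,2,3) hom1_id2[OF F'] hom1_id2[OF assms(2)] assms(4)]
      interchange[OF assms(1,2) hom1_id2[OF assms(1)] assms(3,4) hom1_id2[OF G']]
      vcomp_id[OF assms(3)] vcomp_id[OF assms(4)]
    by (simp add: whisker_left_def whisker_right_def)
qed

lemma whisker_left_id1:
  assumes "F \<in> hom1 C X Y" "\<eta> \<in> hom2 C F G"
  shows "id1 C Y \<rhd> \<eta> = \<eta>"
  using hcomp_id[OF assms] by (simp add: whisker_left_def)

lemma whisker_right_id1:
  assumes "F \<in> hom1 C X Y" "\<eta> \<in> hom2 C F G"
  shows "\<eta> \<lhd> id1 C X = \<eta>"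
  using hcomp_id[OF assms] by (simp add: whisker_right_def)

lemma whisker_right_id2:
  assumes "F \<in> hom1 C X Y" "G \<in> hom1 C Y Z"
  shows "id2 C G \<lhd> F = id2 C (G \<odot> F)"
  using hcomp_id2[OF assms] by (simp add: whisker_right_def)

lemma whisker_left_left:
  assumes "F \<in> hom1 C X Y" "G \<in> hom1 C Y Z" "H \<in> hom1 C Z W" "\<eta> \<in> hom2 C F F'"
  shows "(H \<odot> G) \<rhd> \<eta> = H \<rhd> (G \<rhd> \<eta>)"
  using hcomp_assoc[OF assms(1,2,3,4) hom1_id2[OF assms(2)] hom1_id2[OF assms(3)]]
    hcomp_id2[OF assms(2,3)]
  by (simp add: whisker_left_def)

lemma whisker_right_right:
  assumes "F \<in> hom1 C X Y" "G \<in> hom1 C Y Z" "H \<in> hom1 C Z W" "\<eta> \<in> hom2 C H H'"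
  shows "(\<eta> \<lhd> G) \<lhd> F = \<eta> \<lhd> (G \<odot> F)"
  using hcomp_assoc[OF assms(1,2,3) hom1_id2[OF assms(1)] hom1_id2[OF assms(2)] assms(4)]
    hcomp_id2[OF assms(1,2)]
  by (simp add: whisker_right_def)

lemma whisker_left_right:
  assumes "F \<in> hom1 C X Y" "G \<in> hom1 C Y Z" "H \<in> hom1 C Z W" "\<eta> \<in> hom2 C G G'"
  shows "(H \<rhd> \<eta>) \<lhd> F = H \<rhd> (\<eta> \<lhd> F)"
  using hcomp_assoc[OF assms(1,2,3) hom1_id2[OF assms(1)] assms(4) hom1_id2[OF assms(3)]]
  by (simp add: whisker_right_def whisker_left_def)

section \<open>Transposition along the adjunction\<close>

lemma adj_unit_hom:
  assumes "adjunction C A L R unit counit" and a: "a \<in> hom1 C X A"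
  shows "unit \<lhd> a \<in> hom2 C a (R \<odot> (L \<odot> a))"
proof -
  have L: "L \<in> hom1 C A A" and R: "R \<in> hom1 C A A" and u: "unit \<in> hom2 C (id1 C A) (R \<odot> L)"
    using assms(1) by (auto simp: adjunction_def)
  have I: "id1 C A \<in> hom1 C A A" by (rule id1_hom[OF hom1_obj(2)[OF a]])
  show ?thesis
    using whisker_right_hom[OF a I u] comp1_id[OF a] comp1_assoc[OF a L R] by simp
qed

lemma adj_counit_hom:
  assumes "adjunction C A L R unit counit" and b: "b \<in> hom1 C X A"
  shows "counit \<lhd> b \<in> hom2 C (L \<odot> (R \<odot> b)) b"
proof -
  have L: "L \<in> hom1 C A A" and R: "R \<in> hom1 C A A" and e: "counit \<in> hom2 C (L \<odot> R) (id1 C A)"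
    using assms(1) by (auto simp: adjunction_def)
  show ?thesis
    using whisker_right_hom[OF b comp1_hom[OF R L] e] comp1_id[OF b] comp1_assoc[OF b R L] by simp
qed

lemma adj_hom:
  assumes "adjunction C A L R unit counit"
    and a: "a \<in> hom1 C X A" and h: "h \<in> hom2 C (L \<odot> a) b"
  shows "adj C R unit a h \<in> hom2 C a (R \<odot> b)"
proof -
  have L: "L \<in> hom1 C A A" and R: "R \<in> hom1 C A A"
    using assms(1) by (auto simp: adjunction_def)
  show ?thesis
    unfolding adj_def
    by (rule vcomp_hom[OF adj_unit_hom[OF assms(1) a] whisker_left_hom[OF comp1_hom[OF a L] R h]])
qed

lemma adj_postcompose:
  assumes "adjunction C A L R unit counit"
    and a: "a \<in> hom1 C X A" and h: "h \<in> hom2 C (L \<odot> a) b" and f: "f \<in> hom2 C b b'"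
  shows "adj C R unit a (f \<bullet> h) = (R \<rhd> f) \<bullet> adj C R unit a h"
proof -
  have L: "L \<in> hom1 C A A" and R: "R \<in> hom1 C A A"
    using assms(1) by (auto simp: adjunction_def)
  have La: "L \<odot> a \<in> hom1 C X A" by (rule comp1_hom[OF a L])
  have b: "b \<in> hom1 C X A" by (rule hom2_cod_hom1[OF La h])
  note ua = adj_unit_hom[OF assms(1) a]
  show ?thesis
    unfolding adj_def whisker_left_vcomp[OF La R h f]
    by (rule vcomp_assoc[OF ua whisker_left_hom[OF La R h] whisker_left_hom[OF b R f]])
qed

lemma adj_precompose:
  assumes "adjunction C A L R unit counit"
    and a: "a \<in> hom1 C X A" and h: "h \<in> hom2 C (L \<odot> a) b" and z: "z \<in> hom2 C a' a"
    and a': "a' \<in> hom1 C X A"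
  shows "adj C R unit a' (h \<bullet> (L \<rhd> z)) = adj C R unit a h \<bullet> z"
proof -
  have L: "L \<in> hom1 C A A" and R: "R \<in> hom1 C A A" and u: "unit \<in> hom2 C (id1 C A) (R \<odot> L)"
    using assms(1) by (auto simp: adjunction_def)
  have I: "id1 C A \<in> hom1 C A A" using id1_hom hom1_obj[OF a] by blast
  have La: "L \<odot> a \<in> hom1 C X A" by (rule comp1_hom[OF a L])
  have La': "L \<odot> a' \<in> hom1 C X A" by (rule comp1_hom[OF a' L])
  have b: "b \<in> hom1 C X A" by (rule hom2_cod_hom1[OF La h])
  note ua = adj_unit_hom[OF assms(1) a]
  note ua' = adj_unit_hom[OF assms(1) a']
  have Lz: "L \<rhd> z \<in> hom2 C (L \<odot> a') (L \<odot> a)" by (rule whisker_left_hom[OF a' L z])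
  have Rh: "R \<rhd> h \<in> hom2 C (R \<odot> (L \<odot> a)) (R \<odot> b)" by (rule whisker_left_hom[OF La R h])
  have RLz: "R \<rhd> (L \<rhd> z) \<in> hom2 C (R \<odot> (L \<odot> a')) (R \<odot> (L \<odot> a))"
    by (rule whisker_left_hom[OF La' R Lz])
  have nat: "(R \<rhd> (L \<rhd> z)) \<bullet> (unit \<lhd> a') = (unit \<lhd> a) \<bullet> z"
    using whisker_naturality[OF a' I z u] whisker_left_id1[OF a' z] whisker_left_left[OF a' L R z]
    by simp
  have "adj C R unit a' (h \<bullet> (L \<rhd> z)) = ((R \<rhd> h) \<bullet> (R \<rhd> (L \<rhd> z))) \<bullet> (unit \<lhd> a')"
    by (simp add: adj_def whisker_left_vcomp[OF La' R Lz h])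
  also have "\<dots> = (R \<rhd> h) \<bullet> ((unit \<lhd> a) \<bullet> z)"
    using vcomp_assoc[OF ua' RLz Rh] nat by simp
  also have "\<dots> = adj C R unit a h \<bullet> z"
    using vcomp_assoc[OF z ua Rh] by (simp add: adj_def)
  finally show ?thesis .
qed

text \<open>The preimage of \<open>k\<close> is its transpose \<open>(counit \<lhd> b) \<bullet> (L \<rhd> k)\<close>; this uses the triangle identity at \<open>R\<close>.\<close>

lemma adj_surj:
  assumes "adjunction C A L R unit counit"
    and a: "a \<in> hom1 C X A" and b: "b \<in> hom1 C X A" and k: "k \<in> hom2 C a (R \<odot> b)"
  obtains h where "h \<in> hom2 C (L \<odot> a) b" "adj C R unit a h = k"
proof -
  have L: "L \<in> hom1 C A A" and R: "R \<in> hom1 C A A" and u: "unit \<in> hom2 C (id1 C A) (R \<odot> L)"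
    and e: "counit \<in> hom2 C (L \<odot> R) (id1 C A)"
    and tri: "(R \<rhd> counit) \<bullet> (unit \<lhd> R) = id2 C R"
    using assms(1) by (auto simp: adjunction_def)
  have I: "id1 C A \<in> hom1 C A A" using id1_hom hom1_obj[OF a] by blast
  have Rb: "R \<odot> b \<in> hom1 C X A" by (rule comp1_hom[OF b R])
  have LR: "L \<odot> R \<in> hom1 C A A" by (rule comp1_hom[OF R L])
  have La: "L \<odot> a \<in> hom1 C X A" by (rule comp1_hom[OF a L])
  have LRb: "L \<odot> (R \<odot> b) \<in> hom1 C X A" by (rule comp1_hom[OF Rb L])
  have Lk: "L \<rhd> k \<in> hom2 C (L \<odot> a) (L \<odot> (R \<odot> b))" by (rule whisker_left_hom[OF a L k])
  note eb = adj_counit_hom[OF assms(1) b]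
  let ?h = "(counit \<lhd> b) \<bullet> (L \<rhd> k)"
  have h: "?h \<in> hom2 C (L \<odot> a) b" by (rule vcomp_hom[OF Lk eb])
  have RLk: "R \<rhd> (L \<rhd> k) \<in> hom2 C (R \<odot> (L \<odot> a)) (R \<odot> (L \<odot> (R \<odot> b)))"
    by (rule whisker_left_hom[OF La R Lk])
  have Reb: "R \<rhd> (counit \<lhd> b) \<in> hom2 C (R \<odot> (L \<odot> (R \<odot> b))) (R \<odot> b)"
    by (rule whisker_left_hom[OF LRb R eb])
  note ua = adj_unit_hom[OF assms(1) a]
  note uRb = adj_unit_hom[OF assms(1) Rb]
  have nat: "(R \<rhd> (L \<rhd> k)) \<bullet> (unit \<lhd> a) = (unit \<lhd> (R \<odot> b)) \<bullet> k"
    using whisker_naturality[OF a I k u] whisker_left_id1[OF a k] whisker_left_left[OF a L R k]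
    by simp
  note uR = adj_unit_hom[OF assms(1) R]
  have Re: "R \<rhd> counit \<in> hom2 C (R \<odot> (L \<odot> R)) R"
    using whisker_left_hom[OF LR R e] comp1_id[OF R] by simp
  have tri_b: "(R \<rhd> (counit \<lhd> b)) \<bullet> (unit \<lhd> (R \<odot> b)) = id2 C (R \<odot> b)"
    using whisker_right_vcomp[OF b R uR Re] tri whisker_right_id2[OF b R]
      whisker_left_right[OF b LR R e] whisker_right_right[OF b R I u]
    by simp
  have "adj C R unit a ?h = ((R \<rhd> (counit \<lhd> b)) \<bullet> (R \<rhd> (L \<rhd> k))) \<bullet> (unit \<lhd> a)"
    by (simp add: adj_def whisker_left_vcomp[OF La R Lk eb])
  also have "\<dots> = ((R \<rhd> (counit \<lhd> b)) \<bullet> (unit \<lhd> (R \<odot> b))) \<bullet> k"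
    using vcomp_assoc[OF ua RLk Reb] vcomp_assoc[OF k uRb Reb] nat by simp
  also have "\<dots> = k" using tri_b vcomp_id[OF k] by simp
  finally show thesis using h that by blast
qed

text \<open>By the triangle identity at \<open>L\<close>, transposing back recovers \<open>h\<close> from its adjunct.\<close>

lemma adj_inj:
  assumes "adjunction C A L R unit counit"
    and a: "a \<in> hom1 C X A" and h: "h \<in> hom2 C (L \<odot> a) b" and h': "h' \<in> hom2 C (L \<odot> a) b"
    and eq: "adj C R unit a h = adj C R unit a h'"
  shows "h = h'"
proof -
  have L: "L \<in> hom1 C A A" and R: "R \<in> hom1 C A A" and u: "unit \<in> hom2 C (id1 C A) (R \<odot> L)"
    and e: "counit \<in> hom2 C (L \<odot> R) (id1 C A)"
    and tri: "(counit \<lhd> L) \<bullet> (L \<rhd> unit) = id2 C L"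
    using assms(1) by (auto simp: adjunction_def)
  have I: "id1 C A \<in> hom1 C A A" using id1_hom hom1_obj[OF a] by blast
  have La: "L \<odot> a \<in> hom1 C X A" by (rule comp1_hom[OF a L])
  have RLa: "R \<odot> (L \<odot> a) \<in> hom1 C X A" by (rule comp1_hom[OF La R])
  have LR: "L \<odot> R \<in> hom1 C A A" by (rule comp1_hom[OF R L])
  have b: "b \<in> hom1 C X A" by (rule hom2_cod_hom1[OF La h])
  note ua = adj_unit_hom[OF assms(1) a]
  have Lua: "L \<rhd> (unit \<lhd> a) \<in> hom2 C (L \<odot> a) (L \<odot> (R \<odot> (L \<odot> a)))"
    by (rule whisker_left_hom[OF a L ua])
  note eLa = adj_counit_hom[OF assms(1) La]
  note eb = adj_counit_hom[OF assms(1) b]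
  have Lu: "L \<rhd> unit \<in> hom2 C L (L \<odot> (R \<odot> L))"
    using whisker_left_hom[OF I L u] comp1_id[OF L] by simp
  note eL = adj_counit_hom[OF assms(1) L]
  have tri_a: "(counit \<lhd> (L \<odot> a)) \<bullet> (L \<rhd> (unit \<lhd> a)) = id2 C (L \<odot> a)"
    using whisker_right_vcomp[OF a L Lu eL] tri whisker_right_id2[OF a L]
      whisker_left_right[OF a I L u] whisker_right_right[OF a L LR e]
    by simp
  have "(counit \<lhd> b) \<bullet> (L \<rhd> adj C R unit a g) = g" if g: "g \<in> hom2 C (L \<odot> a) b" for g
  proof -
    have Rg: "R \<rhd> g \<in> hom2 C (R \<odot> (L \<odot> a)) (R \<odot> b)" by (rule whisker_left_hom[OF La R g])
    have LRg: "L \<rhd> (R \<rhd> g) \<in> hom2 C (L \<odot> (R \<odot> (L \<odot> a))) (L \<odot> (R \<odot> b))"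
      by (rule whisker_left_hom[OF RLa L Rg])
    have nat: "(counit \<lhd> b) \<bullet> (L \<rhd> (R \<rhd> g)) = g \<bullet> (counit \<lhd> (L \<odot> a))"
      using whisker_naturality[OF La LR g e] whisker_left_id1[OF La g] whisker_left_left[OF La R L g]
      by simp
    have "(counit \<lhd> b) \<bullet> (L \<rhd> adj C R unit a g)
        = (counit \<lhd> b) \<bullet> ((L \<rhd> (R \<rhd> g)) \<bullet> (L \<rhd> (unit \<lhd> a)))"
      by (simp add: adj_def whisker_left_vcomp[OF a L ua Rg])
    also have "\<dots> = g \<bullet> ((counit \<lhd> (L \<odot> a)) \<bullet> (L \<rhd> (unit \<lhd> a)))"
      using vcomp_assoc[OF Lua LRg eb] vcomp_assoc[OF Lua eLa g] nat by simp
    also have "\<dots> = g" using tri_a vcomp_id[OF g] by simp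
    finally show ?thesis .
  qed
  then show ?thesis using h h' eq by metis
qed

end


section \<open>Homotopies with strict inverses\<close>

text \<open>
  The 2-arrow \<open>y\<close> folds the two halves of a subdivided interval onto one interval, the half \<open>r1\<close>, which a
  concatenation traverses first, being reversed. Its last equation says that the path which runs back and then
  forth is the constant path at the end point.
\<close>

locale inverse_cylinder = formal_category +
  fixes Cyl :: 'f and i0 i1 p v :: 'c and S :: 'f and r0 r1 s y :: 'c
  assumes cylinder: "cylinder C A Cyl i0 i1"
    and contraction: "contraction C A Cyl i0 i1 p"
    and involution: "involution C Cyl i0 i1 v"
    and involution_compatible: "involution_compatible C p v"
    and subdivision: "subdivision C A Cyl i0 i1 S r0 r1 s"
    and cancel_hom: "y \<in> hom2 C S Cyl"
    and cancel: "y \<bullet> r0 = id2 C Cyl" "y \<bullet> r1 = v" "y \<bullet> s = i1 \<bullet> p"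
begin

lemma structure_hom:
  shows id_A: "id1 C A \<in> hom1 C A A"
    and Cyl: "Cyl \<in> hom1 C A A" and S: "S \<in> hom1 C A A"
    and i0: "i0 \<in> hom2 C (id1 C A) Cyl" and i1: "i1 \<in> hom2 C (id1 C A) Cyl"
    and p: "p \<in> hom2 C Cyl (id1 C A)" and v: "v \<in> hom2 C Cyl Cyl"
    and r0: "r0 \<in> hom2 C Cyl S" and r1: "r1 \<in> hom2 C Cyl S" and s: "s \<in> hom2 C Cyl S"
  using id1_hom[OF A_obj] cylinder contraction involution subdivision
  by (auto simp: cylinder_def contraction_def involution_def subdivision_def)

lemma Cyl_point: "a \<in> hom1 C T A \<Longrightarrow> Cyl \<odot> a \<in> hom1 C T A"
  using comp1_hom Cyl by blast

lemma component_hom: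
  assumes a: "a \<in> hom1 C T A"
  shows "i0 \<lhd> a \<in> hom2 C a (Cyl \<odot> a)" "i1 \<lhd> a \<in> hom2 C a (Cyl \<odot> a)"
    "p \<lhd> a \<in> hom2 C (Cyl \<odot> a) a" "v \<lhd> a \<in> hom2 C (Cyl \<odot> a) (Cyl \<odot> a)"
    "r0 \<lhd> a \<in> hom2 C (Cyl \<odot> a) (S \<odot> a)" "r1 \<lhd> a \<in> hom2 C (Cyl \<odot> a) (S \<odot> a)"
    "s \<lhd> a \<in> hom2 C (Cyl \<odot> a) (S \<odot> a)" "y \<lhd> a \<in> hom2 C (S \<odot> a) (Cyl \<odot> a)"
  using whisker_right_hom[OF a id_A i0] whisker_right_hom[OF a id_A i1]
    whisker_right_hom[OF a Cyl p] whisker_right_hom[OF a Cyl v]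
    whisker_right_hom[OF a Cyl r0] whisker_right_hom[OF a Cyl r1]
    whisker_right_hom[OF a Cyl s] whisker_right_hom[OF a S cancel_hom] comp1_id[OF a]
  by simp_all

lemma component_eq:
  assumes a: "a \<in> hom1 C T A"
  shows "p \<lhd> a \<bullet> i0 \<lhd> a = id2 C a" "p \<lhd> a \<bullet> i1 \<lhd> a = id2 C a"
    "v \<lhd> a \<bullet> i0 \<lhd> a = i1 \<lhd> a" "v \<lhd> a \<bullet> i1 \<lhd> a = i0 \<lhd> a" "p \<lhd> a \<bullet> v \<lhd> a = p \<lhd> a"
    "s \<lhd> a \<bullet> i0 \<lhd> a = r1 \<lhd> a \<bullet> i0 \<lhd> a" "s \<lhd> a \<bullet> i1 \<lhd> a = r0 \<lhd> a \<bullet> i1 \<lhd> a"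
    "y \<lhd> a \<bullet> r0 \<lhd> a = id2 C (Cyl \<odot> a)" "y \<lhd> a \<bullet> r1 \<lhd> a = v \<lhd> a"
    "y \<lhd> a \<bullet> s \<lhd> a = i1 \<lhd> a \<bullet> p \<lhd> a"
  using contraction involution involution_compatible subdivision cancel
    whisker_right_vcomp[OF a id_A i0 p] whisker_right_vcomp[OF a id_A i1 p]
    whisker_right_vcomp[OF a id_A i0 v] whisker_right_vcomp[OF a id_A i1 v]
    whisker_right_vcomp[OF a Cyl v p]
    whisker_right_vcomp[OF a id_A i0 s] whisker_right_vcomp[OF a id_A i0 r1]
    whisker_right_vcomp[OF a id_A i1 s] whisker_right_vcomp[OF a id_A i1 r0]
    whisker_right_vcomp[OF a Cyl r0 cancel_hom] whisker_right_vcomp[OF a Cyl r1 cancel_hom]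
    whisker_right_vcomp[OF a Cyl s cancel_hom] whisker_right_vcomp[OF a Cyl p i1]
    whisker_right_id2[OF a id_A] whisker_right_id2[OF a Cyl] comp1_id[OF a]
  by (simp_all add: contraction_def involution_def involution_compatible_def subdivision_def)

lemma component_naturality:
  assumes a: "a \<in> hom1 C T A" and u: "u \<in> hom2 C a b"
  shows "Cyl \<rhd> u \<in> hom2 C (Cyl \<odot> a) (Cyl \<odot> b)"
    and "i0 \<lhd> b \<bullet> u = Cyl \<rhd> u \<bullet> i0 \<lhd> a" "i1 \<lhd> b \<bullet> u = Cyl \<rhd> u \<bullet> i1 \<lhd> a"
    and "p \<lhd> b \<bullet> Cyl \<rhd> u = u \<bullet> p \<lhd> a" "v \<lhd> b \<bullet> Cyl \<rhd> u = Cyl \<rhd> u \<bullet> v \<lhd> a"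
  using whisker_left_hom[OF a Cyl u] whisker_left_id1[OF a u]
    whisker_naturality[OF a id_A u i0] whisker_naturality[OF a id_A u i1]
    whisker_naturality[OF a Cyl u p] whisker_naturality[OF a Cyl u v]
  by simp_all

definition homotopy :: "'f \<Rightarrow> 'f \<Rightarrow> 'c \<Rightarrow> 'c \<Rightarrow> 'c \<Rightarrow> bool" where
  "homotopy a b g h H \<longleftrightarrow> H \<in> hom2 C (Cyl \<odot> a) b \<and> H \<bullet> i0 \<lhd> a = g \<and> H \<bullet> i1 \<lhd> a = h"

lemma homotopy_reverse:
  assumes a: "a \<in> hom1 C T A" and H: "homotopy a b g h H"
  shows "homotopy a b h g (H \<bullet> v \<lhd> a)"
proof -
  have HH: "H \<in> hom2 C (Cyl \<odot> a) b" using H by (simp add: homotopy_def)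
  note c = component_hom[OF a]
  show ?thesis
    using H vcomp_hom[OF c(4) HH] vcomp_assoc[OF c(1) c(4) HH] vcomp_assoc[OF c(2) c(4) HH]
    by (simp add: homotopy_def component_eq[OF a])
qed

lemma homotopy_postcompose:
  assumes a: "a \<in> hom1 C T A" and H: "homotopy a b g h H" and f: "f \<in> hom2 C b b'"
  shows "homotopy a b' (f \<bullet> g) (f \<bullet> h) (f \<bullet> H)"
proof -
  have HH: "H \<in> hom2 C (Cyl \<odot> a) b" using H by (simp add: homotopy_def)
  note c = component_hom[OF a]
  show ?thesis
    using H vcomp_hom[OF HH f] vcomp_assoc[OF c(1) HH f] vcomp_assoc[OF c(2) HH f]
    by (simp add: homotopy_def)
qed

lemma homotopy_precompose:
  assumes a: "a \<in> hom1 C T A" and H: "homotopy a b g h H"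
    and a': "a' \<in> hom1 C T A" and u: "u \<in> hom2 C a' a"
  shows "homotopy a' b (g \<bullet> u) (h \<bullet> u) (H \<bullet> Cyl \<rhd> u)"
proof -
  have HH: "H \<in> hom2 C (Cyl \<odot> a) b" using H by (simp add: homotopy_def)
  note c = component_hom[OF a] and c' = component_hom[OF a']
    and n = component_naturality[OF a' u]
  show ?thesis
    using H vcomp_hom[OF n(1) HH] vcomp_assoc[OF c'(1) n(1) HH] vcomp_assoc[OF c'(2) n(1) HH]
      vcomp_assoc[OF u c(1) HH] vcomp_assoc[OF u c(2) HH]
    by (simp add: homotopy_def n(2,3))
qed

text \<open>
  The pushout property of \<open>S\<close> at a point. As \<open>s\<close> starts in the half \<open>r1\<close> and ends in the half \<open>r0\<close>,
  \<open>N\<close> is the first and \<open>M\<close> the second homotopy of a concatenation.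
\<close>

lemma subdivision_glue:
  assumes a: "a \<in> hom1 C T A" and b: "b \<in> hom1 C T A"
    and M: "M \<in> hom2 C (Cyl \<odot> a) b" and N: "N \<in> hom2 C (Cyl \<odot> a) b"
    and eq: "M \<bullet> i0 \<lhd> a = N \<bullet> i1 \<lhd> a"
  shows "\<exists>!w. w \<in> hom2 C (S \<odot> a) b \<and> w \<bullet> r0 \<lhd> a = M \<and> w \<bullet> r1 \<lhd> a = N"
proof -
  have "pushout_square C T A (i0 \<lhd> a) (i1 \<lhd> a) (r0 \<lhd> a) (r1 \<lhd> a)"
    using eval_pushout[OF A_obj A_obj a] subdivision by (simp add: subdivision_def)
  then have "\<forall>z \<in> hom1 C T A. \<forall>h0 \<in> hom2 C (Cyl \<odot> a) z. \<forall>h1 \<in> hom2 C (Cyl \<odot> a) z.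
      h0 \<bullet> i0 \<lhd> a = h1 \<bullet> i1 \<lhd> a \<longrightarrow>
        (\<exists>!w. w \<in> hom2 C (S \<odot> a) z \<and> w \<bullet> r0 \<lhd> a = h0 \<and> w \<bullet> r1 \<lhd> a = h1)"
    using component_hom[OF a] by (auto simp: pushout_square_def hom2_def)
  then show ?thesis using b M N eq by blast
qed

lemma homotopy_concat:
  assumes a: "a \<in> hom1 C T A" and b: "b \<in> hom1 C T A"
    and N: "homotopy a b g h N" and M: "homotopy a b h k M"
  obtains w where "w \<in> hom2 C (S \<odot> a) b" "w \<bullet> r0 \<lhd> a = M" "w \<bullet> r1 \<lhd> a = N"
    "homotopy a b g k (w \<bullet> s \<lhd> a)"
proof -
  note c = component_hom[OF a]
  obtain w where w: "w \<in> hom2 C (S \<odot> a) b" "w \<bullet> r0 \<lhd> a = M" "w \<bullet> r1 \<lhd> a = N"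
    using subdivision_glue[OF a b, of M N] M N by (auto simp: homotopy_def)
  have "homotopy a b g k (w \<bullet> s \<lhd> a)"
    unfolding homotopy_def
  proof (intro conjI)
    show "w \<bullet> s \<lhd> a \<in> hom2 C (Cyl \<odot> a) b" by (rule vcomp_hom[OF c(7) w(1)])
    show "w \<bullet> s \<lhd> a \<bullet> i0 \<lhd> a = g"
      using vcomp_assoc[OF c(1) c(7) w(1)] vcomp_assoc[OF c(1) c(6) w(1)] w(3) N
      by (simp add: component_eq[OF a] homotopy_def)
    show "w \<bullet> s \<lhd> a \<bullet> i1 \<lhd> a = k"
      using vcomp_assoc[OF c(2) c(7) w(1)] vcomp_assoc[OF c(2) c(5) w(1)] w(2) M
      by (simp add: component_eq[OF a] homotopy_def)
  qed
  with w that show thesis by blast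
qed

text \<open>
  If \<open>f\<close> sends \<open>N\<close> to the reverse of \<open>f \<bullet> M\<close>, then \<open>f\<close> sends the glued arrow on \<open>S \<odot> a\<close> to \<open>f \<bullet> M \<bullet> (y \<lhd> a)\<close>,
  because both agree on the two halves. Restricting along \<open>s\<close> then gives \<open>f \<bullet> M \<bullet> (i1 \<lhd> a) \<bullet> (p \<lhd> a)\<close>.
\<close>

lemma homotopy_concat_cancel:
  assumes a: "a \<in> hom1 C T A" and b: "b \<in> hom1 C T A"
    and N: "homotopy a b g h N" and M: "homotopy a b h k M"
    and f: "f \<in> hom2 C b b'" and inv: "f \<bullet> N = f \<bullet> M \<bullet> v \<lhd> a"
  obtains H where "homotopy a b g k H" "f \<bullet> H = f \<bullet> k \<bullet> p \<lhd> a"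
proof -
  note c = component_hom[OF a]
  have MM: "M \<in> hom2 C (Cyl \<odot> a) b" and k: "M \<bullet> i1 \<lhd> a = k" using M by (auto simp: homotopy_def)
  have fM: "f \<bullet> M \<in> hom2 C (Cyl \<odot> a) b'" by (rule vcomp_hom[OF MM f])
  have fN: "f \<bullet> N \<in> hom2 C (Cyl \<odot> a) b'" using N vcomp_hom[OF _ f] by (auto simp: homotopy_def)
  have b': "b' \<in> hom1 C T A" by (rule hom2_cod_hom1[OF b f])
  obtain w where w: "w \<in> hom2 C (S \<odot> a) b" "w \<bullet> r0 \<lhd> a = M" "w \<bullet> r1 \<lhd> a = N"
    and H: "homotopy a b g k (w \<bullet> s \<lhd> a)"
    using homotopy_concat[OF a b N M] by blast
  have "f \<bullet> M \<bullet> i0 \<lhd> a = f \<bullet> N \<bullet> i1 \<lhd> a"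
    using homotopy_postcompose[OF a M f] homotopy_postcompose[OF a N f]
    by (simp add: homotopy_def)
  then have "\<exists>!w. w \<in> hom2 C (S \<odot> a) b' \<and> w \<bullet> r0 \<lhd> a = f \<bullet> M \<and> w \<bullet> r1 \<lhd> a = f \<bullet> N"
    using subdivision_glue[OF a b' fM fN] by blast
  moreover have "f \<bullet> w \<bullet> r0 \<lhd> a = f \<bullet> M" "f \<bullet> w \<bullet> r1 \<lhd> a = f \<bullet> N"
    using vcomp_assoc[OF c(5) w(1) f] vcomp_assoc[OF c(6) w(1) f] w by simp_all
  moreover have "f \<bullet> M \<bullet> y \<lhd> a \<bullet> r0 \<lhd> a = f \<bullet> M" "f \<bullet> M \<bullet> y \<lhd> a \<bullet> r1 \<lhd> a = f \<bullet> N"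
    using vcomp_assoc[OF c(5) c(8) fM] vcomp_assoc[OF c(6) c(8) fM] vcomp_id[OF fM] inv
    by (simp_all add: component_eq[OF a])
  ultimately have fw: "f \<bullet> w = f \<bullet> M \<bullet> y \<lhd> a"
    using vcomp_hom[OF w(1) f] vcomp_hom[OF c(8) fM] by metis
  have "f \<bullet> (w \<bullet> s \<lhd> a) = f \<bullet> M \<bullet> y \<lhd> a \<bullet> s \<lhd> a"
    using vcomp_assoc[OF c(7) w(1) f] fw by simp
  also have "\<dots> = f \<bullet> M \<bullet> (i1 \<lhd> a \<bullet> p \<lhd> a)"
    using vcomp_assoc[OF c(7) c(8) fM] by (simp add: component_eq[OF a])
  also have "\<dots> = f \<bullet> M \<bullet> i1 \<lhd> a \<bullet> p \<lhd> a"
    using vcomp_assoc[OF c(3) c(2) fM] by simp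
  also have "f \<bullet> M \<bullet> i1 \<lhd> a = f \<bullet> k"
    using vcomp_assoc[OF c(2) MM f] k by simp
  finally show thesis using H that by blast
qed

section \<open>Trivial fibrations are strictly shrinkable\<close>

definition lifts_homotopies :: "'f \<Rightarrow> 'f \<Rightarrow> 'c \<Rightarrow> ('f \<Rightarrow> 'c \<Rightarrow> 'c \<Rightarrow> 'c) \<Rightarrow> bool" where
  "lifts_homotopies b b' f K \<longleftrightarrow>
    (\<forall>a \<in> hom1 C T A. \<forall>g \<in> hom2 C a b. \<forall>H \<in> hom2 C (Cyl \<odot> a) b'.
      H \<bullet> i0 \<lhd> a = f \<bullet> g \<longrightarrow>
      K a g H \<in> hom2 C (Cyl \<odot> a) b \<and> f \<bullet> K a g H = H \<and> K a g H \<bullet> i0 \<lhd> a = g)"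

text \<open>
  The analogue of Dold's theorem on fibre homotopy equivalences. The homotopy \<open>D\<close> constructed first covers
  some loop at \<open>f\<close>; a homotopy covering the inverse loop, inserted before it, cancels that loop strictly.
\<close>

lemma shrinkable:
  assumes b: "b \<in> hom1 C T A" and b': "b' \<in> hom1 C T A" and f: "f \<in> hom2 C b b'"
    and lift: "lifts_homotopies b b' f K"
    and f': "f' \<in> hom2 C b' b"
    and M: "homotopy b b (f' \<bullet> f) (id2 C b) M"
    and N: "homotopy b' b' (f \<bullet> f') (id2 C b') N"
  obtains t H where "t \<in> hom2 C b' b" "f \<bullet> t = id2 C b'"
    "homotopy b b (t \<bullet> f) (id2 C b) H" "f \<bullet> H = f \<bullet> p \<lhd> b"
proof -
  note c = component_hom[OF b] and c' = component_hom[OF b']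
  \<comment> \<open>Move \<open>f'\<close> along a lift of \<open>N\<close> until it becomes a section.\<close>
  define L where "L = K b' f' N"
  have L: "L \<in> hom2 C (Cyl \<odot> b') b" "f \<bullet> L = N" "L \<bullet> i0 \<lhd> b' = f'"
    using lift N f' b' by (auto simp: L_def lifts_homotopies_def homotopy_def)
  define t where "t = L \<bullet> i1 \<lhd> b'"
  have t: "t \<in> hom2 C b' b" unfolding t_def by (rule vcomp_hom[OF c'(2) L(1)])
  have ft: "f \<bullet> t = id2 C b'"
    using vcomp_assoc[OF c'(2) L(1) f] L(2) N by (simp add: t_def homotopy_def)
  have tf: "t \<bullet> f \<in> hom2 C b b" by (rule vcomp_hom[OF f t])
  have "homotopy b' b f' t L" using L by (simp add: homotopy_def t_def)
  then have D0: "homotopy b b (t \<bullet> f) (f' \<bullet> f) (L \<bullet> Cyl \<rhd> f \<bullet> v \<lhd> b)"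
    by (rule homotopy_reverse[OF b homotopy_precompose[OF b' _ b f]])
  obtain D where D: "homotopy b b (t \<bullet> f) (id2 C b) D"
    by (rule homotopy_concat[OF b b D0 M])
  then have DD: "D \<in> hom2 C (Cyl \<odot> b) b" by (simp add: homotopy_def)
  have ftf: "f \<bullet> (t \<bullet> f) = f"
    using vcomp_assoc[OF f t f] ft vcomp_id[OF f] by simp
  \<comment> \<open>Over \<open>b'\<close> the homotopy \<open>D\<close> is a loop at \<open>f\<close>; the homotopy \<open>t \<bullet> f \<bullet> (D \<bullet> v \<lhd> b)\<close> covers its
    inverse, and since \<open>t \<bullet> f\<close> is idempotent it ends where \<open>D\<close> starts.\<close>
  have "t \<bullet> f \<bullet> (t \<bullet> f) = t \<bullet> f"
    using vcomp_assoc[OF tf f t] ftf by simp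
  then have E: "homotopy b b (t \<bullet> f) (t \<bullet> f) (t \<bullet> f \<bullet> (D \<bullet> v \<lhd> b))"
    using homotopy_postcompose[OF b homotopy_reverse[OF b D] tf] vcomp_id[OF tf] by simp
  have "f \<bullet> (t \<bullet> f \<bullet> (D \<bullet> v \<lhd> b)) = f \<bullet> (t \<bullet> f) \<bullet> (D \<bullet> v \<lhd> b)"
    using vcomp_assoc[OF vcomp_hom[OF c(4) DD] tf f] by simp
  also have "\<dots> = f \<bullet> D \<bullet> v \<lhd> b"
    using vcomp_assoc[OF c(4) DD f] ftf by simp
  finally obtain H where "homotopy b b (t \<bullet> f) (id2 C b) H" "f \<bullet> H = f \<bullet> id2 C b \<bullet> p \<lhd> b"
    using homotopy_concat_cancel[OF b b E D f] by blast
  then show thesis using that t ft vcomp_id[OF f] by simp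
qed

section \<open>Lifting cofibrations\<close>

text \<open>
  Naturality along \<open>j\<close> together with normality at \<open>g0\<close> keeps the correcting homotopy constant on \<open>a0\<close>,
  where the lift is prescribed.
\<close>

lemma cofibration_lift:
  assumes a0: "a0 \<in> hom1 C T A" and a1: "a1 \<in> hom1 C T A"
    and b: "b \<in> hom1 C T A" and b': "b' \<in> hom1 C T A" and f: "f \<in> hom2 C b b'"
    and j: "cofibration C T A Cyl i0 a0 a1 j"
    and lift: "lifts_homotopies b b' f K"
    and normal: "\<And>a g. \<lbrakk>a \<in> hom1 C T A; g \<in> hom2 C a b\<rbrakk> \<Longrightarrow>
          K a g (f \<bullet> g \<bullet> p \<lhd> a) = g \<bullet> p \<lhd> a"
    and natural: "\<And>a a' u g H. \<lbrakk>a \<in> hom1 C T A; a' \<in> hom1 C T A; u \<in> hom2 C a' a;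
          g \<in> hom2 C a b; H \<in> hom2 C (Cyl \<odot> a) b'; H \<bullet> i0 \<lhd> a = f \<bullet> g\<rbrakk> \<Longrightarrow>
          K a' (g \<bullet> u) (H \<bullet> Cyl \<rhd> u) = K a g H \<bullet> Cyl \<rhd> u"
    and t: "t \<in> hom2 C b' b" "f \<bullet> t = id2 C b'"
    and H: "homotopy b b (t \<bullet> f) (id2 C b) H" "f \<bullet> H = f \<bullet> p \<lhd> b"
    and g0: "g0 \<in> hom2 C a0 b" and g1: "g1 \<in> hom2 C a1 b'" and sq: "f \<bullet> g0 = g1 \<bullet> j"
  shows "\<exists>l \<in> hom2 C a1 b. l \<bullet> j = g0 \<and> f \<bullet> l = g1"
proof -
  note c0 = component_hom[OF a0] and c1 = component_hom[OF a1] and cb = component_hom[OF b]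
  have jj: "j \<in> hom2 C a0 a1" using j by (simp add: cofibration_def)
  note nj = component_naturality[OF a0 jj] and ng = component_naturality[OF a0 g0]
  have HH: "H \<in> hom2 C (Cyl \<odot> b) b" using H(1) by (simp add: homotopy_def)
  define h where "h = H \<bullet> Cyl \<rhd> g0"
  have h: "homotopy a0 b (t \<bullet> f \<bullet> g0) g0 h"
    using homotopy_precompose[OF b H(1) a0 g0] vcomp_id[OF g0] by (simp add: h_def)
  then have hh: "h \<in> hom2 C (Cyl \<odot> a0) b" by (simp add: homotopy_def)
  have fg0: "f \<bullet> g0 \<in> hom2 C a0 b'" by (rule vcomp_hom[OF g0 f])
  have fh: "f \<bullet> h = f \<bullet> g0 \<bullet> p \<lhd> a0"
    using vcomp_assoc[OF ng(1) HH f] vcomp_assoc[OF ng(1) cb(3) f] vcomp_assoc[OF c0(3) g0 f]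
    by (simp add: h_def H(2) ng(4))
  have tg1: "t \<bullet> g1 \<in> hom2 C a1 b" by (rule vcomp_hom[OF g1 t(1)])
  have "h \<bullet> i0 \<lhd> a0 = t \<bullet> g1 \<bullet> j"
    using h vcomp_assoc[OF g0 f t(1)] vcomp_assoc[OF jj g1 t(1)] sq
    by (simp add: homotopy_def)
  then obtain k where k: "k \<in> hom2 C (Cyl \<odot> a1) b" "k \<bullet> Cyl \<rhd> j = h" "k \<bullet> i0 \<lhd> a1 = t \<bullet> g1"
    using j b tg1 hh unfolding cofibration_def by meson
  define q where "q = k \<bullet> i1 \<lhd> a1"
  have q: "q \<in> hom2 C a1 b" unfolding q_def by (rule vcomp_hom[OF c1(2) k(1)])
  have "homotopy a1 b (t \<bullet> g1) q k" using k by (simp add: homotopy_def q_def)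
  moreover have "f \<bullet> (t \<bullet> g1) = g1"
    using vcomp_assoc[OF g1 t(1) f] t(2) vcomp_id[OF g1] by simp
  ultimately have P: "homotopy a1 b' (f \<bullet> q) g1 (f \<bullet> k \<bullet> v \<lhd> a1)"
    using homotopy_reverse[OF a1 homotopy_postcompose[OF a1 _ f]] by metis
  \<comment> \<open>The lift of the reversed homotopy carries \<open>q\<close> to an arrow over \<open>g1\<close>.\<close>
  define L where "L = K a1 q (f \<bullet> k \<bullet> v \<lhd> a1)"
  have L: "L \<in> hom2 C (Cyl \<odot> a1) b" "f \<bullet> L = f \<bullet> k \<bullet> v \<lhd> a1"
    using lift a1 q P by (auto simp: L_def lifts_homotopies_def homotopy_def)
  define l where "l = L \<bullet> i1 \<lhd> a1"
  have l: "l \<in> hom2 C a1 b" unfolding l_def by (rule vcomp_hom[OF c1(2) L(1)])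
  have fl: "f \<bullet> l = g1"
    using vcomp_assoc[OF c1(2) L(1) f] L(2) P by (simp add: l_def homotopy_def)
  have qj: "q \<bullet> j = g0"
    using vcomp_assoc[OF jj c1(2) k(1)] vcomp_assoc[OF c0(2) nj(1) k(1)] k(2) h
    by (simp add: q_def nj(3) homotopy_def)
  have fk: "f \<bullet> k \<in> hom2 C (Cyl \<odot> a1) b'" by (rule vcomp_hom[OF k(1) f])
  have "f \<bullet> k \<bullet> v \<lhd> a1 \<bullet> Cyl \<rhd> j = f \<bullet> k \<bullet> Cyl \<rhd> j \<bullet> v \<lhd> a0"
    using vcomp_assoc[OF nj(1) c1(4) fk] vcomp_assoc[OF c0(4) nj(1) fk] by (simp add: nj(5))
  also have "\<dots> = f \<bullet> g0 \<bullet> p \<lhd> a0 \<bullet> v \<lhd> a0"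
    using vcomp_assoc[OF nj(1) k(1) f] k(2) fh by simp
  also have "\<dots> = f \<bullet> g0 \<bullet> p \<lhd> a0"
    using vcomp_assoc[OF c0(4) c0(3) fg0] by (simp add: component_eq[OF a0])
  finally have Pj: "f \<bullet> k \<bullet> v \<lhd> a1 \<bullet> Cyl \<rhd> j = f \<bullet> g0 \<bullet> p \<lhd> a0" .
  have "L \<bullet> Cyl \<rhd> j = K a0 (q \<bullet> j) (f \<bullet> k \<bullet> v \<lhd> a1 \<bullet> Cyl \<rhd> j)"
    unfolding L_def using natural[OF a1 a0 jj q] P by (simp add: homotopy_def)
  then have Lj: "L \<bullet> Cyl \<rhd> j = g0 \<bullet> p \<lhd> a0"
    using normal[OF a0 g0] by (simp add: qj Pj)
  have "l \<bullet> j = L \<bullet> Cyl \<rhd> j \<bullet> i1 \<lhd> a0"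
    using vcomp_assoc[OF jj c1(2) L(1)] vcomp_assoc[OF c0(2) nj(1) L(1)]
    by (simp add: l_def nj(3))
  also have "\<dots> = g0"
    using vcomp_assoc[OF c0(2) c0(3) g0] vcomp_id[OF g0] by (simp add: Lj component_eq[OF a0])
  finally show ?thesis using l fl by blast
qed

section \<open>Transposing the fibration structure\<close>

text \<open>
  \<open>K a g H\<close> is the arrow whose adjunct is the chosen lift of the adjunct of \<open>H\<close>. Each property of \<open>K\<close> can be
  tested on adjuncts, where it is the corresponding property of the cleavage; normality transfers because
  the adjunction matches \<open>p\<close> with \<open>c\<close>.
\<close>

lemma cloven_fibration_lifting:
  assumes adjoint: "cyl_left_adjoint C T A Cyl i0 i1 coCyl e0 e1 unit counit"
    and c: "cocontraction C A coCyl e0 e1 c"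
    and compat: "adjunction_compatible C T A coCyl unit p c"
    and b: "b \<in> hom1 C T A" and b': "b' \<in> hom1 C T A"
    and fib: "normally_cloven_fibration C T A coCyl e0 c b b' f"
  obtains K where "lifts_homotopies b b' f K"
    "\<And>a g. \<lbrakk>a \<in> hom1 C T A; g \<in> hom2 C a b\<rbrakk> \<Longrightarrow>
          K a g (f \<bullet> g \<bullet> p \<lhd> a) = g \<bullet> p \<lhd> a"
    "\<And>a a' u g H. \<lbrakk>a \<in> hom1 C T A; a' \<in> hom1 C T A; u \<in> hom2 C a' a;
          g \<in> hom2 C a b; H \<in> hom2 C (Cyl \<odot> a) b'; H \<bullet> i0 \<lhd> a = f \<bullet> g\<rbrakk> \<Longrightarrow>
          K a' (g \<bullet> u) (H \<bullet> Cyl \<rhd> u) = K a g H \<bullet> Cyl \<rhd> u"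
proof -
  let ?adj = "adj C coCyl unit"
  have ad: "adjunction C A Cyl coCyl unit counit"
    and e0: "\<And>a d H. \<lbrakk>a \<in> hom1 C T A; d \<in> hom1 C T A; H \<in> hom2 C (Cyl \<odot> a) d\<rbrakk>
          \<Longrightarrow> e0 \<lhd> d \<bullet> ?adj a H = H \<bullet> i0 \<lhd> a"
    using adjoint by (auto simp: cyl_left_adjoint_def)
  have pc: "\<And>a d g. \<lbrakk>a \<in> hom1 C T A; d \<in> hom1 C T A; g \<in> hom2 C a d\<rbrakk>
          \<Longrightarrow> ?adj a (g \<bullet> p \<lhd> a) = c \<lhd> d \<bullet> g"
    using compat by (auto simp: adjunction_compatible_def)
  have f: "f \<in> hom2 C b b'" using fib by (simp add: normally_cloven_fibration_def)
  have "c \<in> hom2 C (id1 C A) coCyl" using c by (simp add: cocontraction_def)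
  then have cb': "c \<lhd> b' \<in> hom2 C b' (coCyl \<odot> b')"
    using whisker_right_hom[OF b' id_A] comp1_id[OF b'] by metis
  obtain k where k: "cleavage C T A coCyl e0 b b' f k"
    and k_normal: "\<And>a g. \<lbrakk>a \<in> hom1 C T A; g \<in> hom2 C a b\<rbrakk> \<Longrightarrow>
          k a g (c \<lhd> b' \<bullet> f \<bullet> g) = c \<lhd> b \<bullet> g"
    and k_natural: "\<And>a a' u g h. \<lbrakk>a \<in> hom1 C T A; a' \<in> hom1 C T A; u \<in> hom2 C a' a;
          g \<in> hom2 C a b; h \<in> hom2 C a (coCyl \<odot> b'); e0 \<lhd> b' \<bullet> h = f \<bullet> g\<rbrakk> \<Longrightarrow>
          k a' (g \<bullet> u) (h \<bullet> u) = k a g h \<bullet> u"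
    using fib unfolding normally_cloven_fibration_def by blast
  define K where "K a g H = (SOME G. G \<in> hom2 C (Cyl \<odot> a) b \<and> ?adj a G = k a g (?adj a H))" for a g H
  have K: "K a g H \<in> hom2 C (Cyl \<odot> a) b" "?adj a (K a g H) = k a g (?adj a H)"
    "f \<bullet> K a g H = H" "K a g H \<bullet> i0 \<lhd> a = g"
    if a: "a \<in> hom1 C T A" and g: "g \<in> hom2 C a b" and H: "H \<in> hom2 C (Cyl \<odot> a) b'"
      and start: "H \<bullet> i0 \<lhd> a = f \<bullet> g" for a g H
  proof -
    have aH: "?adj a H \<in> hom2 C a (coCyl \<odot> b')" by (rule adj_hom[OF ad a H])
    have kk: "k a g (?adj a H) \<in> hom2 C a (coCyl \<odot> b)"
      "coCyl \<rhd> f \<bullet> k a g (?adj a H) = ?adj a H" "e0 \<lhd> b \<bullet> k a g (?adj a H) = g"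
      using k a g aH e0[OF a b' H] start by (auto simp: cleavage_def)
    have "\<exists>G. G \<in> hom2 C (Cyl \<odot> a) b \<and> ?adj a G = k a g (?adj a H)"
      using adj_surj[OF ad a b kk(1)] by blast
    then have *: "K a g H \<in> hom2 C (Cyl \<odot> a) b \<and> ?adj a (K a g H) = k a g (?adj a H)"
      unfolding K_def by (rule someI_ex)
    then show KK: "K a g H \<in> hom2 C (Cyl \<odot> a) b" "?adj a (K a g H) = k a g (?adj a H)" by auto
    show "f \<bullet> K a g H = H"
      using adj_inj[OF ad a vcomp_hom[OF KK(1) f] H] adj_postcompose[OF ad a KK(1) f] KK(2) kk(2)
      by simp
    show "K a g H \<bullet> i0 \<lhd> a = g" using e0[OF a b KK(1)] KK(2) kk(3) by simp
  qed
  show thesis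
  proof (rule that)
    show "lifts_homotopies b b' f K" using K by (simp add: lifts_homotopies_def)
  next
    fix a g assume a: "a \<in> hom1 C T A" and g: "g \<in> hom2 C a b"
    note ca = component_hom[OF a]
    have fg: "f \<bullet> g \<in> hom2 C a b'" by (rule vcomp_hom[OF g f])
    have c_b': "c \<lhd> b' \<bullet> (f \<bullet> g) = c \<lhd> b' \<bullet> f \<bullet> g"
      using vcomp_assoc[OF g f cb'] by simp
    have fgp: "f \<bullet> g \<bullet> p \<lhd> a \<in> hom2 C (Cyl \<odot> a) b'" by (rule vcomp_hom[OF ca(3) fg])
    have start: "f \<bullet> g \<bullet> p \<lhd> a \<bullet> i0 \<lhd> a = f \<bullet> g"
      using vcomp_assoc[OF ca(1) ca(3) fg] vcomp_id[OF fg] by (simp add: component_eq[OF a])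
    note KK = K[OF a g fgp start]
    have "?adj a (K a g (f \<bullet> g \<bullet> p \<lhd> a)) = ?adj a (g \<bullet> p \<lhd> a)"
      using KK(2) k_normal[OF a g] by (simp add: pc[OF a b' fg] pc[OF a b g] c_b')
    then show "K a g (f \<bullet> g \<bullet> p \<lhd> a) = g \<bullet> p \<lhd> a"
      by (rule adj_inj[OF ad a KK(1) vcomp_hom[OF ca(3) g]])
  next
    fix a a' u g H
    assume a: "a \<in> hom1 C T A" and a': "a' \<in> hom1 C T A" and u: "u \<in> hom2 C a' a"
      and g: "g \<in> hom2 C a b" and H: "H \<in> hom2 C (Cyl \<odot> a) b'"
      and start: "H \<bullet> i0 \<lhd> a = f \<bullet> g"
    note nu = component_naturality[OF a' u] and ca = component_hom[OF a]
      and ca' = component_hom[OF a']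
    note KK = K[OF a g H start]
    have gu: "g \<bullet> u \<in> hom2 C a' b" by (rule vcomp_hom[OF u g])
    have Hu: "H \<bullet> Cyl \<rhd> u \<in> hom2 C (Cyl \<odot> a') b'" by (rule vcomp_hom[OF nu(1) H])
    have start': "H \<bullet> Cyl \<rhd> u \<bullet> i0 \<lhd> a' = f \<bullet> (g \<bullet> u)"
      using vcomp_assoc[OF ca'(1) nu(1) H] vcomp_assoc[OF u ca(1) H] vcomp_assoc[OF u g f] start
      by (simp add: nu(2))
    note KK' = K[OF a' gu Hu start']
    have "k a' (g \<bullet> u) (?adj a H \<bullet> u) = k a g (?adj a H) \<bullet> u"
      using k_natural[OF a a' u g adj_hom[OF ad a H]] e0[OF a b' H] start by simp
    then have "?adj a' (K a' (g \<bullet> u) (H \<bullet> Cyl \<rhd> u)) = ?adj a' (K a g H \<bullet> Cyl \<rhd> u)"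
      using KK(2) KK'(2) adj_precompose[OF ad a H u a'] adj_precompose[OF ad a KK(1) u a'] by simp
    then show "K a' (g \<bullet> u) (H \<bullet> Cyl \<rhd> u) = K a g H \<bullet> Cyl \<rhd> u"
      by (rule adj_inj[OF ad a' KK'(1) vcomp_hom[OF nu(1) KK(1)]])
  qed
qed

lemma cocyl_homotopy_transpose:
  assumes adjoint: "cyl_left_adjoint C T A Cyl i0 i1 coCyl e0 e1 unit counit"
    and a: "a \<in> hom1 C T A" and b: "b \<in> hom1 C T A"
    and h: "cocyl_homotopy C coCyl e0 e1 a b g g' h"
  obtains H where "homotopy a b g g' H"
proof -
  have ad: "adjunction C A Cyl coCyl unit counit"
    using adjoint by (simp add: cyl_left_adjoint_def)
  obtain H where H: "H \<in> hom2 C (Cyl \<odot> a) b" "adj C coCyl unit a H = h"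
    using adj_surj[OF ad a b] h by (auto simp: cocyl_homotopy_def)
  have "homotopy a b g g' H"
    using adjoint a b H h by (auto simp: cyl_left_adjoint_def cocyl_homotopy_def homotopy_def)
  then show thesis by (rule that)
qed

end

section \<open>The lifting theorem\<close>

text \<open>
  The side \<open>Cyl \<rhd> i1\<close> of \<open>\<Gamma>lr\<close> is the identity and that of \<open>\<Gamma>ur\<close> is \<open>v\<close>, so \<open>y = x \<bullet> (S \<rhd> i1)\<close> has the
  required values on \<open>r0\<close> and \<open>r1\<close>; the compatibility \<open>x \<bullet> (s \<lhd> Cyl) = p \<lhd> Cyl\<close> gives its value on \<open>s\<close>.
\<close>

lemma (in strict_2_category) strict_left_inverse:
  assumes Cyl: "Cyl \<in> hom1 C A A" and i0: "i0 \<in> hom2 C (id1 C A) Cyl"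
    and i1: "i1 \<in> hom2 C (id1 C A) Cyl" and p: "p \<in> hom2 C Cyl (id1 C A)"
    and sub: "subdivision C A Cyl i0 i1 S r0 r1 s"
    and lr: "lower_right_connection C Cyl i0 i1 p \<Gamma>lr"
    and ur: "upper_right_connection C Cyl i0 i1 p v \<Gamma>ur"
    and compat: "connections_compatible C Cyl p S r0 r1 s \<Gamma>lr \<Gamma>ur"
  obtains y where "y \<in> hom2 C S Cyl" "y \<bullet> r0 = id2 C Cyl" "y \<bullet> r1 = v" "y \<bullet> s = i1 \<bullet> p"
proof -
  have I: "id1 C A \<in> hom1 C A A" using id1_hom hom1_obj[OF Cyl] by blast
  have S: "S \<in> hom1 C A A" and r0: "r0 \<in> hom2 C Cyl S" and r1: "r1 \<in> hom2 C Cyl S"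
    and s: "s \<in> hom2 C Cyl S"
    using sub by (auto simp: subdivision_def)
  obtain x where x: "x \<in> hom2 C (S \<odot> Cyl) Cyl" "x \<bullet> r0 \<lhd> Cyl = \<Gamma>lr" "x \<bullet> r1 \<lhd> Cyl = \<Gamma>ur"
    "x \<bullet> s \<lhd> Cyl = p \<lhd> Cyl"
    using compat by (auto simp: connections_compatible_def unique_factorization_def)
  have Si1: "S \<rhd> i1 \<in> hom2 C S (S \<odot> Cyl)"
    using whisker_left_hom[OF I S i1] comp1_id[OF S] by simp
  have Ci1: "Cyl \<rhd> i1 \<in> hom2 C Cyl (Cyl \<odot> Cyl)"
    using whisker_left_hom[OF I Cyl i1] comp1_id[OF Cyl] by simp
  have slide: "x \<bullet> S \<rhd> i1 \<bullet> r = x \<bullet> r \<lhd> Cyl \<bullet> Cyl \<rhd> i1" if r: "r \<in> hom2 C Cyl S" for r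
    using whisker_naturality[OF I Cyl i1 r] whisker_right_id1[OF Cyl r]
      vcomp_assoc[OF r Si1 x(1)] vcomp_assoc[OF Ci1 whisker_right_hom[OF Cyl Cyl r] x(1)]
    by simp
  have "p \<lhd> Cyl \<bullet> Cyl \<rhd> i1 = i1 \<bullet> p"
    using whisker_naturality[OF I Cyl i1 p] whisker_right_id1[OF Cyl p] whisker_left_id1[OF I i1]
    by simp
  then have "x \<bullet> S \<rhd> i1 \<bullet> r0 = id2 C Cyl" "x \<bullet> S \<rhd> i1 \<bullet> r1 = v" "x \<bullet> S \<rhd> i1 \<bullet> s = i1 \<bullet> p"
    using slide[OF r0] slide[OF r1] slide[OF s] x lr ur
    by (simp_all add: lower_right_connection_def upper_right_connection_def)
  then show thesis by (rule that[OF vcomp_hom[OF Si1 x(1)]])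
qed

theorem mainTheorem15:
  fixes C :: "('o, 'f, 'c, 'm) two_cat_scheme" (structure)
  assumes "formal_category C T A"
    and "cylinder C A Cyl i0 i1"
    and "contraction C A Cyl i0 i1 p"
    and "involution C Cyl i0 i1 v" and "involution_compatible C p v"
    and "subdivision C A Cyl i0 i1 S r0 r1 s" and "subdivision_compatible C A p S r0 r1 s"
    and "upper_left_connection C Cyl i0 i1 p \<Gamma>ul"
    and "lower_right_connection C Cyl i0 i1 p \<Gamma>lr"
    and "upper_right_connection C Cyl i0 i1 p v \<Gamma>ur"
    and "has_mapping_cylinders C T A Cyl i0"
    and "connections_compatible C Cyl p S r0 r1 s \<Gamma>lr \<Gamma>ur"
    and "preserves_mapping_cylinders C T A Cyl i0"
    and "cocylinder C A coCyl e0 e1"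
    and "cocontraction C A coCyl e0 e1 c"
    and "cyl_left_adjoint C T A Cyl i0 i1 coCyl e0 e1 unit counit"
    and "adjunction_compatible C T A coCyl unit p c"
    and "a0 \<in> hom1 C T A" and "a1 \<in> hom1 C T A" and "a2 \<in> hom1 C T A" and "a3 \<in> hom1 C T A"
    and "cofibration C T A Cyl i0 a0 a1 j"
    and "trivial_normally_cloven_fibration C T A coCyl e0 e1 c a2 a3 f"
    and "g0 \<in> hom2 C a0 a2" and "g1 \<in> hom2 C a1 a3"
    and "f \<bullet> g0 = g1 \<bullet> j"
  shows "\<exists>l \<in> hom2 C a1 a2. l \<bullet> j = g0 \<and> f \<bullet> l = g1"
proof -
  interpret formal_category C T A by (rule assms(1))
  have Cyl: "Cyl \<in> hom1 C A A" "i0 \<in> hom2 C (id1 C A) Cyl" "i1 \<in> hom2 C (id1 C A) Cyl"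
    and p: "p \<in> hom2 C Cyl (id1 C A)"
    using assms(2,3) by (auto simp: cylinder_def contraction_def)
  obtain y where y: "y \<in> hom2 C S Cyl" "y \<bullet> r0 = id2 C Cyl" "y \<bullet> r1 = v" "y \<bullet> s = i1 \<bullet> p"
    using strict_left_inverse[OF Cyl p assms(6,9,10,12)] by blast
  interpret inverse_cylinder C T A Cyl i0 i1 p v S r0 r1 s y
    using assms(2-6) y by unfold_locales auto
  have fib: "normally_cloven_fibration C T A coCyl e0 c a2 a3 f" and f: "f \<in> hom2 C a2 a3"
    using assms(23)
    by (auto simp: trivial_normally_cloven_fibration_def normally_cloven_fibration_def)
  obtain f' h h' where f': "f' \<in> hom2 C a3 a2"
    and h: "cocyl_homotopy C coCyl e0 e1 a2 a2 (f' \<bullet> f) (id2 C a2) h"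
    and h': "cocyl_homotopy C coCyl e0 e1 a3 a3 (f \<bullet> f') (id2 C a3) h'"
    using assms(23)
    by (auto simp: trivial_normally_cloven_fibration_def cocyl_homotopy_equivalence_def)
  obtain M where M: "homotopy a2 a2 (f' \<bullet> f) (id2 C a2) M"
    by (rule cocyl_homotopy_transpose[OF assms(16,20,20) h])
  obtain N where N: "homotopy a3 a3 (f \<bullet> f') (id2 C a3) N"
    by (rule cocyl_homotopy_transpose[OF assms(16,21,21) h'])
  obtain K where K: "lifts_homotopies a2 a3 f K"
    "\<And>a g. \<lbrakk>a \<in> hom1 C T A; g \<in> hom2 C a a2\<rbrakk> \<Longrightarrow>
          K a g (f \<bullet> g \<bullet> p \<lhd> a) = g \<bullet> p \<lhd> a"
    "\<And>a a' u g H. \<lbrakk>a \<in> hom1 C T A; a' \<in> hom1 C T A; u \<in> hom2 C a' a;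
          g \<in> hom2 C a a2; H \<in> hom2 C (Cyl \<odot> a) a3; H \<bullet> i0 \<lhd> a = f \<bullet> g\<rbrakk> \<Longrightarrow>
          K a' (g \<bullet> u) (H \<bullet> Cyl \<rhd> u) = K a g H \<bullet> Cyl \<rhd> u"
    by (rule cloven_fibration_lifting[OF assms(16,15,17,20,21) fib]) blast
  obtain t H where t: "t \<in> hom2 C a3 a2" "f \<bullet> t = id2 C a3"
    "homotopy a2 a2 (t \<bullet> f) (id2 C a2) H" "f \<bullet> H = f \<bullet> p \<lhd> a2"
    by (rule shrinkable[OF assms(20,21) f K(1) f' M N])
  show ?thesis
    by (rule cofibration_lift[OF assms(18-21) f assms(22) K t assms(24-26)])
qed

end
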